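(* Let $(\mathscr G,\mathscr H)$ be a compact Friedrichs module with Gelfand triplet $\mathscr G\subset\mathscr H\subset\mathscr G^*$. Let $A,B$ be closed densely defined operators in $\mathscr H$ with $\rho(A)\cap\rho(B)\neq\emptyset$ such that: $\mathcal D(A)\subset\mathscr G$ densely, $\mathcal D(A^* )\subset\mathscr G$, $\mathcal D(B)\subset\mathscr G$, and $A,B$ extend to continuous operators $\widetilde A,\widetilde B\in\mathcal B(\mathscr G,\mathscr G^* )$. Assume that there are a Banach module $\mathscr K$ and operators $S\in\mathcal B(\mathscr K,\mathscr G^* )$ and $T\in\mathcal B_0^{\,l}(\mathscr G,\mathscr K)$ such that $\widetilde B-\widetilde A=ST$ and $(A-z)^{-1}S\in\mathcal B_q^{\,l}(\mathscr K,\mathscr H)$ for some $z\in\rho(A)\cap\rho(B)$. Then $B$ is a compact perturbation of $A$ and $\sigma_{\rm ess}(B)=\sigma_{\rm ess}(A)$.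
   Context: $\mathcal B(\cdot,\cdot)$ and $\mathcal K(\cdot,\cdot)$ denote bounded and compact linear operators; $\rho(\cdot)$ is the resolvent set. A Banach module is a pair consisting of a Banach space $\mathscr H$ and a norm-closed subalgebra $\mathcal M(\mathscr H)$ of $\mathcal B(\mathscr H)$ (the multiplier algebra) which is non-degenerate (the linear span of $\{Mu: M\in\mathcal M(\mathscr H),u\in\mathscr H\}$ is dense in $\mathscr H$) and has an approximate unit (a norm-bounded net $J_\alpha\in\mathcal M(\mathscr H)$ with $\|J_\alpha M-M\|\to0$ and $\|MJ_\alpha-M\|\to0$ for all $M\in\mathcal M(\mathscr H)$). It is a Hilbert module if $\mathscr H$ is a Hilbert space and $\mathcal M(\mathscr H)$ is a $C^*$-algebra of operators. A Friedrichs module is a pair $(\mathscr G,\mathscr H)$ with $\mathscr H$ a Hilbert module and $\mathscr G$ a Hilbert space with $\mathscr G\subset\mathscr H$ continuously and densely; it is compact if each $M\in\mathcal M(\mathscr H)$, restricted to $\mathscr G$, is a compact operator $\mathscr G\to\mathscr H$. The adjoint space $\mathscr G^*$ is the space of antilinear continuous forms; identifying $\mathscr H^*=\mathscr H$ by the Riesz isomorphism gives the Gelfand triplet $\mathscr G\subset\mathscr H\subset\mathscr G^*$. If $\mathscr F$ is a Banach space and $\mathscr K$ a Banach module, $\mathcal B_0^{\,l}(\mathscr F,\mathscr K)$ is the norm-closed linear span of the operators $MT$ with $M\in\mathcal M(\mathscr K)$, $T\in\mathcal B(\mathscr F,\mathscr K)$. If $\mathscr K,\mathscr H$ are Banach modules,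 $\mathcal B_q^{\,l}(\mathscr K,\mathscr H)$ (left decay preserving operators) is the set of $S\in\mathcal B(\mathscr K,\mathscr H)$ such that $SM\in\mathcal B_0^{\,l}(\mathscr K,\mathscr H)$ for every $M\in\mathcal M(\mathscr K)$. Under the assumptions on $A$, for $z\in\rho(A)$ one has $((A-z)^{-1})^*\mathscr H\subset\mathscr G$, so $(A-z)^{-1}$ extends to a unique continuous operator $\mathscr G^*\to\mathscr H$, still denoted $(A-z)^{-1}$; this is the operator occurring in $(A-z)^{-1}S$. $B$ is a compact perturbation of $A$ if there is $z\in\rho(A)\cap\rho(B)$ such that $(A-z)^{-1}-(B-z)^{-1}$ is a compact operator on $\mathscr H$. $\sigma_{\rm ess}(A)$ is the set of $\lambda\in\mathbb C$ such that $A-\lambda$ is not Fredholm. *)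

theory Defs
  imports "HOL-Analysis.Analysis"
begin

section \<open>Complex normed spaces and complex Hilbert spaces\<close>

text \<open>
  The distribution only has real normed and real inner product spaces. The classes below add a
  compatible complex structure, so that the underlying real space keeps all library notions
  (norm, topology, completeness, bounded linear functions).
\<close>

class scaleC = scaleR +
  fixes scaleC :: "complex \<Rightarrow> 'a \<Rightarrow> 'a"  (infixr \<open>*\<^sub>C\<close> 75)
  assumes scaleR_scaleC: "scaleR r = scaleC (complex_of_real r)"

class complex_vector = real_vector + scaleC +
  assumes scaleC_add_right: "a *\<^sub>C (x + y) = a *\<^sub>C x + a *\<^sub>C y"
    and scaleC_add_left: "(a + b) *\<^sub>C x = a *\<^sub>C x + b *\<^sub>C x"
    and scaleC_scaleC: "a *\<^sub>C b *\<^sub>C x = (a * b) *\<^sub>C x"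
    and scaleC_one: "1 *\<^sub>C x = x"

global_interpretation complex_vector:
  vector_space "scaleC :: complex \<Rightarrow> 'a \<Rightarrow> 'a :: complex_vector"
  by standard (simp_all add: scaleC_add_right scaleC_add_left scaleC_scaleC scaleC_one)

class complex_normed_vector = complex_vector + real_normed_vector +
  assumes norm_scaleC: "norm (a *\<^sub>C x) = cmod a * norm x"

class cbanach = complex_normed_vector + banach

text \<open>
  The inner product is antilinear in its first argument and linear in its second one.
\<close>

class complex_inner = complex_normed_vector + real_inner +
  fixes cinner :: "'a \<Rightarrow> 'a \<Rightarrow> complex"
  assumes cinner_commute: "cinner x y = cnj (cinner y x)"
    and cinner_add_right: "cinner x (y + z) = cinner x y + cinner x z"
    and cinner_scaleC_right: "cinner x (c *\<^sub>C y) = c * cinner x y"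
    and inner_eq_Re_cinner: "inner x y = Re (cinner x y)"

class chilbert_space = complex_inner + banach

subclass (in chilbert_space) cbanach ..

instantiation complex :: complex_normed_vector
begin
definition scaleC_complex :: "complex \<Rightarrow> complex \<Rightarrow> complex"
  where "scaleC_complex a x = a * x"
instance
  by standard (auto simp: scaleC_complex_def algebra_simps norm_mult scaleR_conv_of_real fun_eq_iff)
end

lemma cinner_self: "cinner x x = complex_of_real ((norm x)\<^sup>2)"
  using cinner_commute[of x x] power2_norm_eq_inner[of x] inner_eq_Re_cinner[of x x]
  by (auto simp: complex_eq_iff)

lemma cinner_scaleC_left: "cinner (c *\<^sub>C x) y = cnj c * cinner x y"
  by (metis cinner_commute cinner_scaleC_right complex_cnj_mult)

lemma cinner_add_left: "cinner (x + y) z = cinner x z + cinner y z"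
  by (metis cinner_commute cinner_add_right complex_cnj_add)

lemma cmod_cinner_le: "cmod (cinner x y) \<le> norm x * norm y"
proof -
  define c where "c = cnj (sgn (cinner x y))"
  have "c * cinner x y = complex_of_real (cmod (cinner x y))"
    by (cases "cinner x y = 0")
      (simp_all add: c_def sgn_eq complex_norm_square[symmetric] power2_eq_square
        mult.commute[of "cnj _"])
  hence "cmod (cinner x y) = Re (cinner x (c *\<^sub>C y))"
    by (simp add: cinner_scaleC_right)
  also have "\<dots> \<le> norm x * norm (c *\<^sub>C y)"
    unfolding inner_eq_Re_cinner[symmetric] by (rule norm_cauchy_schwarz)
  also have "\<dots> \<le> norm x * norm y"
    by (simp add: norm_scaleC c_def norm_sgn)
  finally show ?thesis .
qed

lemma scaleC_scaleR_commute: "a *\<^sub>C r *\<^sub>R x = r *\<^sub>R a *\<^sub>C (x :: 'a :: complex_vector)"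
  by (simp add: scaleR_scaleC scaleC_scaleC mult.commute)

lemma bounded_linear_scaleC_comp:
  fixes f :: "'a :: real_normed_vector \<Rightarrow> 'b :: complex_normed_vector"
  assumes "bounded_linear f"
  shows "bounded_linear (\<lambda>x. a *\<^sub>C f x)"
proof -
  have "bounded_linear (\<lambda>y :: 'b. a *\<^sub>C y)"
    by (rule bounded_linear_intro[where K = "cmod a"])
      (simp_all add: scaleC_add_right scaleC_scaleR_commute norm_scaleC)
  from bounded_linear_compose[OF this assms] show ?thesis .
qed

lemma onorm_scaleC:
  fixes f :: "'a :: real_normed_vector \<Rightarrow> 'b :: complex_normed_vector"
  assumes "bounded_linear f"
  shows "onorm (\<lambda>x. a *\<^sub>C f x) = cmod a * onorm f"
proof -
  have "onorm (\<lambda>x. cmod a *\<^sub>R f x) = cmod a * onorm f"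
    using onorm_scaleR[OF assms, of "cmod a"] by simp
  moreover have "onorm (\<lambda>x. a *\<^sub>C f x) = onorm (\<lambda>x. cmod a *\<^sub>R f x)"
    by (simp add: onorm_def norm_scaleC)
  ultimately show ?thesis by simp
qed

instantiation blinfun :: (real_normed_vector, complex_normed_vector) complex_normed_vector
begin
lift_definition scaleC_blinfun :: "complex \<Rightarrow> 'a \<Rightarrow>\<^sub>L 'b \<Rightarrow> 'a \<Rightarrow>\<^sub>L 'b" is "\<lambda>c f x. c *\<^sub>C f x"
  by (rule bounded_linear_scaleC_comp)
instance
  apply standard
  subgoal by (rule ext, transfer) (simp add: scaleR_scaleC)
  subgoal by transfer (simp add: scaleC_add_right)
  subgoal by transfer (simp add: scaleC_add_left)
  subgoal by transfer (simp add: scaleC_scaleC)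
  subgoal by transfer (simp add: scaleC_one)
  subgoal by transfer (simp add: onorm_scaleC)
  done
end


section \<open>Bounded and compact operators\<close>

text \<open>
  The type \<open>'a \<Rightarrow>\<^sub>L 'b\<close> consists of the bounded real-linear maps; the bounded
  operators between complex normed spaces are the complex-linear ones among them, with the same norm.
\<close>

definition bounded_ops :: "('a :: complex_normed_vector \<Rightarrow>\<^sub>L 'b :: complex_normed_vector) set"
  where "bounded_ops = {T. \<forall>c x. blinfun_apply T (c *\<^sub>C x) = c *\<^sub>C blinfun_apply T x}"

definition compact_ops :: "('a :: complex_normed_vector \<Rightarrow>\<^sub>L 'b :: complex_normed_vector) set"
  where "compact_ops = {T \<in> bounded_ops. compact (closure (blinfun_apply T ` cball 0 1))}"


section \<open>The adjoint space\<close>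

typedef (overloaded) ('a :: complex_normed_vector) antidual =
  "{\<phi> :: 'a \<Rightarrow>\<^sub>L complex. \<forall>c x. blinfun_apply \<phi> (c *\<^sub>C x) = cnj c * blinfun_apply \<phi> x}"
  morphisms blinfun_of_antidual Antidual
  by (rule exI[of _ 0]) simp

setup_lifting type_definition_antidual

instantiation antidual :: (complex_normed_vector) complex_normed_vector
begin

lift_definition zero_antidual :: "'a antidual" is 0
  by simp
lift_definition plus_antidual :: "'a antidual \<Rightarrow> 'a antidual \<Rightarrow> 'a antidual" is "(+)"
  by (simp add: blinfun.add_left algebra_simps)
lift_definition minus_antidual :: "'a antidual \<Rightarrow> 'a antidual \<Rightarrow> 'a antidual" is "(-)"
  by (simp add: blinfun.diff_left algebra_simps)
lift_definition uminus_antidual :: "'a antidual \<Rightarrow> 'a antidual" is uminus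
  by (simp add: blinfun.minus_left)
lift_definition scaleR_antidual :: "real \<Rightarrow> 'a antidual \<Rightarrow> 'a antidual" is scaleR
  by (simp add: blinfun.scaleR_left)
lift_definition scaleC_antidual :: "complex \<Rightarrow> 'a antidual \<Rightarrow> 'a antidual" is scaleC
  by (simp add: scaleC_blinfun.rep_eq scaleC_complex_def)
lift_definition norm_antidual :: "'a antidual \<Rightarrow> real" is norm .

definition dist_antidual :: "'a antidual \<Rightarrow> 'a antidual \<Rightarrow> real"
  where "dist_antidual a b = norm (a - b)"
definition sgn_antidual :: "'a antidual \<Rightarrow> 'a antidual"
  where "sgn_antidual x = scaleR (inverse (norm x)) x"
definition uniformity_antidual :: "('a antidual \<times> 'a antidual) filter"
  where "uniformity_antidual = (INF e\<in>{0 <..}. principal {(x, y). dist x y < e})"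
definition open_antidual :: "'a antidual set \<Rightarrow> bool"
  where "open_antidual S = (\<forall>x\<in>S. \<forall>\<^sub>F (x', y) in uniformity. x' = x \<longrightarrow> y \<in> S)"

instance
proof
  fix x y z :: "'a antidual" and a b :: complex and r q :: real
  show "(scaleR r :: 'a antidual \<Rightarrow> _) = scaleC (complex_of_real r)"
    by (rule ext, transfer) (simp add: scaleR_scaleC)
  show "x + y + z = x + (y + z)" "x + y = y + x" "0 + x = x" "- x + x = 0" "x - y = x + - y"
    by (transfer, simp)+
  show "r *\<^sub>R (x + y) = r *\<^sub>R x + r *\<^sub>R y" "(r + q) *\<^sub>R x = r *\<^sub>R x + q *\<^sub>R x"
    "r *\<^sub>R q *\<^sub>R x = (r * q) *\<^sub>R x" "1 *\<^sub>R x = x"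
    by (transfer, simp add: scaleR_add_right scaleR_add_left)+
  show "a *\<^sub>C (x + y) = a *\<^sub>C x + a *\<^sub>C y" "(a + b) *\<^sub>C x = a *\<^sub>C x + b *\<^sub>C x"
    "a *\<^sub>C b *\<^sub>C x = (a * b) *\<^sub>C x" "1 *\<^sub>C x = x"
    by (transfer, simp add: scaleC_add_right scaleC_add_left scaleC_scaleC scaleC_one)+
  show "norm x = 0 \<longleftrightarrow> x = 0" "norm (x + y) \<le> norm x + norm y" "norm (r *\<^sub>R x) = \<bar>r\<bar> * norm x"
    "norm (a *\<^sub>C x) = cmod a * norm x"
    by (transfer, simp add: norm_triangle_ineq norm_scaleC)+
qed (simp_all add: dist_antidual_def sgn_antidual_def uniformity_antidual_def open_antidual_def)

end


section \<open>Banach modules and Friedrichs modules\<close>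

text \<open>
  A net in the algebra is represented by its filter of tails, a proper filter on the algebra.
\<close>

definition has_approximate_unit :: "('k :: complex_normed_vector \<Rightarrow>\<^sub>L 'k) set \<Rightarrow> bool"
  where "has_approximate_unit M \<longleftrightarrow>
    (\<exists>F. F \<noteq> bot \<and> (\<exists>C. \<forall>\<^sub>F J in F. J \<in> M \<and> norm J \<le> C) \<and>
      (\<forall>T\<in>M. ((\<lambda>J. norm ((J o\<^sub>L T) - T)) \<longlongrightarrow> 0) F \<and>
             ((\<lambda>J. norm ((T o\<^sub>L J) - T)) \<longlongrightarrow> 0) F))"

definition banach_module :: "('k :: cbanach \<Rightarrow>\<^sub>L 'k) set \<Rightarrow> bool"
  where "banach_module M \<longleftrightarrow>
    M \<subseteq> bounded_ops \<and> complex_vector.subspace M \<and> (\<forall>S\<in>M. \<forall>T\<in>M. S o\<^sub>L T \<in> M) \<and> closed M \<and>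
    closure (complex_vector.span {blinfun_apply T u | T u. T \<in> M}) = UNIV \<and>
    has_approximate_unit M"

definition hilbert_module :: "('h :: chilbert_space \<Rightarrow>\<^sub>L 'h) set \<Rightarrow> bool"
  where "hilbert_module M \<longleftrightarrow>
    banach_module M \<and>
    (\<forall>S\<in>M. \<exists>S'\<in>M. \<forall>x y. cinner (blinfun_apply S x) y = cinner x (blinfun_apply S' y))"

text \<open>
  The inclusion of the smaller space into the larger one is an injective operator
  \<open>\<iota>\<close>, so that the two spaces can be different types.
\<close>

definition friedrichs_module ::
    "('g :: chilbert_space \<Rightarrow>\<^sub>L 'h :: chilbert_space) \<Rightarrow> ('h \<Rightarrow>\<^sub>L 'h) set \<Rightarrow> bool"
  where "friedrichs_module \<iota> M \<longleftrightarrow>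
    hilbert_module M \<and> \<iota> \<in> bounded_ops \<and> inj (blinfun_apply \<iota>) \<and>
    closure (range (blinfun_apply \<iota>)) = UNIV"

definition compact_friedrichs_module ::
    "('g :: chilbert_space \<Rightarrow>\<^sub>L 'h :: chilbert_space) \<Rightarrow> ('h \<Rightarrow>\<^sub>L 'h) set \<Rightarrow> bool"
  where "compact_friedrichs_module \<iota> M \<longleftrightarrow>
    friedrichs_module \<iota> M \<and> (\<forall>T\<in>M. T o\<^sub>L \<iota> \<in> compact_ops)"

definition gelfand_embedding ::
    "('g :: chilbert_space \<Rightarrow>\<^sub>L 'h :: chilbert_space) \<Rightarrow> 'h \<Rightarrow> 'g antidual"
  where "gelfand_embedding \<iota> v = Antidual (Blinfun (\<lambda>g. cinner (blinfun_apply \<iota> g) v))"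

lemma blinfun_of_gelfand_embedding:
  assumes "\<iota> \<in> bounded_ops"
  shows "blinfun_apply (blinfun_of_antidual (gelfand_embedding \<iota> v)) g =
    cinner (blinfun_apply \<iota> g) v"
proof -
  have "bounded_linear (\<lambda>g. cinner (blinfun_apply \<iota> g) v)"
  proof (rule bounded_linear_intro[where K = "norm \<iota> * norm v"])
    fix x y r
    show "cinner (\<iota> (x + y)) v = cinner (\<iota> x) v + cinner (\<iota> y) v"
      by (simp add: blinfun.add_right cinner_add_left)
    show "cinner (\<iota> (r *\<^sub>R x)) v = r *\<^sub>R cinner (\<iota> x) v"
      using assms by (simp add: bounded_ops_def blinfun.scaleR_right)
        (simp add: scaleR_scaleC cinner_scaleC_left scaleC_complex_def bounded_ops_def)
    have "cmod (cinner (\<iota> x) v) \<le> norm (\<iota> x) * norm v"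
      by (rule cmod_cinner_le)
    also have "\<dots> \<le> (norm \<iota> * norm x) * norm v"
      by (intro mult_right_mono norm_blinfun norm_ge_zero)
    finally show "cmod (cinner (\<iota> x) v) \<le> norm x * (norm \<iota> * norm v)"
      by (simp add: mult_ac)
  qed
  moreover have "\<forall>c x. cinner (\<iota> (c *\<^sub>C x)) v = cnj c * cinner (\<iota> x) v"
    using assms by (simp add: bounded_ops_def cinner_scaleC_left)
  ultimately show ?thesis
    by (simp add: gelfand_embedding_def Antidual_inverse bounded_linear_Blinfun_apply)
qed

definition B0l :: "('k :: cbanach \<Rightarrow>\<^sub>L 'k) set \<Rightarrow> ('f :: complex_normed_vector \<Rightarrow>\<^sub>L 'k) set"
  where "B0l M = closure (complex_vector.span {S o\<^sub>L T | S T. S \<in> M \<and> T \<in> bounded_ops})"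

definition Bql ::
    "('k :: cbanach \<Rightarrow>\<^sub>L 'k) set \<Rightarrow> ('h :: cbanach \<Rightarrow>\<^sub>L 'h) set \<Rightarrow> ('k \<Rightarrow>\<^sub>L 'h) set"
  where "Bql MK MH = {S \<in> bounded_ops. \<forall>T\<in>MK. S o\<^sub>L T \<in> B0l MH}"


section \<open>Unbounded operators\<close>

text \<open>
  An operator is given by its domain \<open>D\<close> and a total function \<open>A\<close> whose
  values outside \<open>D\<close> are irrelevant.
\<close>

definition closed_densely_defined ::
    "'h :: complex_normed_vector set \<Rightarrow> ('h \<Rightarrow> 'h) \<Rightarrow> bool"
  where "closed_densely_defined D A \<longleftrightarrow>
    complex_vector.subspace D \<and>
    (\<forall>x\<in>D. \<forall>y\<in>D. A (x + y) = A x + A y) \<and> (\<forall>c. \<forall>x\<in>D. A (c *\<^sub>C x) = c *\<^sub>C A x) \<and>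
    closed ((\<lambda>x. (x, A x)) ` D) \<and> closure D = UNIV"

definition adjoint_domain :: "'h :: complex_inner set \<Rightarrow> ('h \<Rightarrow> 'h) \<Rightarrow> 'h set"
  where "adjoint_domain D A = {y. \<exists>w. \<forall>x\<in>D. cinner y (A x) = cinner w x}"

definition resolvent_set :: "'h :: complex_normed_vector set \<Rightarrow> ('h \<Rightarrow> 'h) \<Rightarrow> complex set"
  where "resolvent_set D A =
    {z. bij_betw (\<lambda>x. A x - z *\<^sub>C x) D UNIV \<and>
        bounded_linear (inv_into D (\<lambda>x. A x - z *\<^sub>C x))}"

definition resolvent ::
    "'h :: complex_normed_vector set \<Rightarrow> ('h \<Rightarrow> 'h) \<Rightarrow> complex \<Rightarrow> 'h \<Rightarrow>\<^sub>L 'h"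
  where "resolvent D A z = Blinfun (inv_into D (\<lambda>x. A x - z *\<^sub>C x))"

text \<open>
  The extension exists and is unique when \<open>z\<close> is in the resolvent set, \<open>\<iota>\<close> is injective
  with dense range and that range contains the domain of the adjoint.
\<close>

definition extended_resolvent ::
    "('g :: chilbert_space \<Rightarrow>\<^sub>L 'h :: chilbert_space) \<Rightarrow> 'h set \<Rightarrow> ('h \<Rightarrow> 'h) \<Rightarrow> complex \<Rightarrow>
      'g antidual \<Rightarrow>\<^sub>L 'h"
  where "extended_resolvent \<iota> D A z =
    (THE R. R \<in> bounded_ops \<and>
      (\<forall>v. blinfun_apply R (gelfand_embedding \<iota> v) = blinfun_apply (resolvent D A z) v))"

definition extends_to ::
    "('g :: chilbert_space \<Rightarrow>\<^sub>L 'h :: chilbert_space) \<Rightarrow> 'h set \<Rightarrow> ('h \<Rightarrow> 'h) \<Rightarrow>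
      ('g \<Rightarrow>\<^sub>L 'g antidual) \<Rightarrow> bool"
  where "extends_to \<iota> D A A' \<longleftrightarrow>
    A' \<in> bounded_ops \<and> (\<forall>g. blinfun_apply \<iota> g \<in> D \<longrightarrow>
      blinfun_apply A' g = gelfand_embedding \<iota> (A (blinfun_apply \<iota> g)))"

definition compact_perturbation ::
    "'h :: complex_normed_vector set \<Rightarrow> ('h \<Rightarrow> 'h) \<Rightarrow> 'h set \<Rightarrow> ('h \<Rightarrow> 'h) \<Rightarrow> bool"
  where "compact_perturbation DB B DA A \<longleftrightarrow>
    (\<exists>z \<in> resolvent_set DA A \<inter> resolvent_set DB B.
      resolvent DA A z - resolvent DB B z \<in> compact_ops)"

definition fredholm :: "'h :: complex_normed_vector set \<Rightarrow> ('h \<Rightarrow> 'h) \<Rightarrow> bool"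
  where "fredholm D A \<longleftrightarrow>
    (\<exists>b. finite b \<and> {x \<in> D. A x = 0} \<subseteq> complex_vector.span b) \<and>
    closed (A ` D) \<and>
    (\<exists>b. finite b \<and> complex_vector.span (A ` D \<union> b) = UNIV)"

definition essential_spectrum :: "'h :: complex_normed_vector set \<Rightarrow> ('h \<Rightarrow> 'h) \<Rightarrow> complex set"
  where "essential_spectrum D A = {z. \<not> fredholm D (\<lambda>x. A x - z *\<^sub>C x)}"

end

theory Submission
  imports Defs
begin

text \<open>
  Put \<open>R = (A - z)\<inverse> - (B - z)\<inverse>\<close>. Since the domain of \<open>A\<close> is
  dense in \<open>\<G>\<close>, the extended resolvent inverts \<open>At - z\<close> from the left on all of
  \<open>\<G>\<close>, whence \<open>R = (A - z)\<inverse> S T (B - z)\<inverse>\<close> with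
  \<open>(B - z)\<inverse>\<close> bounded into \<open>\<G>\<close> by the closed graph theorem. As
  \<open>T\<close> is a norm limit of sums of \<open>M T'\<close> with \<open>M\<close> a multiplier, and
  \<open>(A - z)\<inverse> S M\<close> is left decaying, \<open>J R \<rightarrow> R\<close> along the approximate unit
  of \<open>\<H>\<close>. But \<open>R\<close> also factors through \<open>\<G>\<close>, so each \<open>J R\<close> is
  compact, and so is \<open>R\<close>.

  For the essential spectra, \<open>A - l\<close> is Fredholm iff the bounded operator
  \<open>1 - (l - z) (A - z)\<inverse>\<close> is, and the Fredholm property of bounded operators is equivalent to
  the existence of a parametrix (Atkinson), which survives compact perturbations. A complex subspace
  of finite dimension or codimension is so over the reals too, hence this part is done in real Hilbert
  spaces.
\<close>

section \<open>Closed graphs and orthogonal projections\<close>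

text \<open>By Baire, the closure of some sublevel set \<open>E n\<close> contains a ball.
  Differences of elements of \<open>E n\<close>, rescaled, approximate every vector up to half its
  norm with control of the image. Repeating this on the remainder writes \<open>x\<close> as a
  series whose images are dominated by a geometric series; the closed graph identifies their sum
  with \<open>f x\<close>.\<close>

theorem closed_graph_bounded_linear:
  fixes f :: "'a::banach \<Rightarrow> 'b::banach"
  assumes lin: "linear f"
    and graph: "\<And>X x y. X \<longlonglongrightarrow> x \<Longrightarrow> (\<lambda>n. f (X n)) \<longlonglongrightarrow> y \<Longrightarrow> y = f x"
  shows "bounded_linear f"
proof -
  define E where "E n = {x. norm (f x) \<le> real n}" for n :: nat
  have "\<exists>n. interior (closure (E n)) \<noteq> {}"
  proof (rule ccontr)
    assume *: "\<nexists>n. interior (closure (E n)) \<noteq> {}"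
    have "Met_TC.mtopology interior_of \<Union>(range (\<lambda>n. closure (E n))) = ({} :: 'a set)"
    proof (rule Met_TC.metric_Baire_category_alt)
      show "Met_TC.mcomplete (TYPE('a))"
        by (simp add: mcomplete_iff_complete complete_UNIV)
    qed (use * in auto)
    moreover have "x \<in> (\<Union>n. closure (E n))" for x
    proof -
      obtain n where "norm (f x) \<le> real n"
        using real_arch_simple by blast
      hence "x \<in> closure (E n)"
        using closure_subset[of "E n"] by (auto simp: E_def)
      thus ?thesis by blast
    qed
    hence "(\<Union>n. closure (E n)) = UNIV" by blast
    ultimately show False by simp
  qed
  then obtain n x0 where "x0 \<in> interior (closure (E n))" by blast
  then obtain r where r: "r > 0" "ball x0 r \<subseteq> closure (E n)"
    by (meson interior_subset open_contains_ball open_interior subset_trans)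
  define C where "C = 4 * real n / r"
  have C0: "C \<ge> 0" using r by (simp add: C_def)
  have "\<exists>a. norm (x - a) \<le> norm x / 2 \<and> norm (f a) \<le> C * norm x" for x
  proof (cases "x = 0")
    case True
    thus ?thesis by (intro exI[of _ 0]) (simp add: linear_0[OF lin])
  next
    case False
    \<comment> \<open>With \<open>t * norm x = r / 2\<close> both \<open>x0\<close> and
      \<open>x0 + t *\<^sub>R x\<close> lie in the ball. Approximating each within
      \<open>r / 8\<close> leaves an error below \<open>r / 4\<close>, which is half of
      \<open>t * norm x\<close>; dividing by \<open>t\<close> yields the factor 1/2 and the constant
      \<open>C\<close>.\<close>
    define t where "t = r / (2 * norm x)"
    have t: "t > 0" "t * norm x = r / 2" using False r by (simp_all add: t_def)
    define d where "d = r / 8"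
    have d: "d > 0" using r by (simp add: d_def)
    have "x0 + t *\<^sub>R x \<in> closure (E n)" "x0 \<in> closure (E n)"
      using r t by (auto simp: dist_norm intro!: subsetD[OF r(2)])
    then obtain a1 a2 where a: "a1 \<in> E n" "dist a1 (x0 + t *\<^sub>R x) < d" "a2 \<in> E n" "dist a2 x0 < d"
      using d unfolding closure_approachable by blast
    define a where "a = (1 / t) *\<^sub>R (a1 - a2)"
    have "t *\<^sub>R (x - a) = (a2 - x0) - (a1 - (x0 + t *\<^sub>R x))"
      using t by (simp add: a_def algebra_simps)
    hence "norm (t *\<^sub>R (x - a)) < 2 * d"
      using a(2,4) norm_triangle_ineq4[of "a2 - x0" "a1 - (x0 + t *\<^sub>R x)"]
      unfolding dist_norm by simp
    hence "t * norm (x - a) < r / 4" using t(1) by (simp add: d_def)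
    hence "t * norm (x - a) \<le> t * norm x / 2" using t(2) r(1) by linarith
    hence 1: "norm (x - a) \<le> norm x / 2"
      using t(1) by (metis mult_le_cancel_left_pos times_divide_eq_right)
    have "norm (f a) = norm (f a1 - f a2) / t"
      using t by (simp add: a_def linear_scale[OF lin] linear_diff[OF lin])
    also have "\<dots> \<le> (2 * real n) / t"
      using a(1,3) norm_triangle_ineq4[of "f a1" "f a2"] t(1)
      by (intro divide_right_mono) (auto simp: E_def)
    also have "\<dots> = C * norm x" using r False by (simp add: t_def C_def)
    finally show ?thesis using 1 by blast
  qed
  then obtain h where h: "\<And>x. norm (x - h x) \<le> norm x / 2" "\<And>x. norm (f (h x)) \<le> C * norm x"
    by metis
  show ?thesis
  proof (rule bounded_linear_intro[where K = "2 * C"])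
    fix x
    \<comment> \<open>\<open>y k\<close> is what remains of \<open>x\<close> after \<open>k\<close>
      approximations. Its norm at least halves each time, so the partial sums \<open>x - y k\<close>
      tend to \<open>x\<close>.\<close>
    define y where "y = rec_nat x (\<lambda>_ y. y - h y)"
    have y: "y 0 = x" "\<And>k. y (Suc k) = y k - h (y k)" by (simp_all add: y_def)
    have ny: "norm (y k) \<le> norm x * (1/2) ^ k" for k
    proof (induction k)
      case (Suc k)
      thus ?case using h(1)[of "y k"] by (simp add: y(2))
    qed (simp add: y)
    have fy: "f (x - y k) = (\<Sum>i<k. f (h (y i)))" for k
      by (induction k) (simp_all add: y linear_0[OF lin] linear_diff[OF lin])
    have geo: "(\<lambda>k. (C * norm x) * (1/2) ^ k) sums (C * norm x * 2)"
      using geometric_sums[of "1/2 :: real"] by (intro sums_mult) simp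
    have le: "norm (f (h (y k))) \<le> (C * norm x) * (1/2) ^ k" for k
      using h(2)[of "y k"] mult_left_mono[OF ny C0, of k] by (simp add: mult_ac)
    have "summable (\<lambda>k. norm (f (h (y k))))"
      by (rule summable_comparison_test'[OF sums_summable[OF geo], of 0]) (use le in auto)
    hence sm: "summable (\<lambda>k. f (h (y k)))" by (rule summable_norm_cancel)
    have "(\<lambda>k. norm x * (1/2) ^ k) \<longlonglongrightarrow> 0"
      by (intro tendsto_mult_right_zero LIMSEQ_power_zero) simp
    hence "y \<longlonglongrightarrow> 0"
      by (rule Lim_null_comparison[rotated]) (simp add: ny)
    hence "(\<lambda>k. x - y k) \<longlonglongrightarrow> x - 0" by (intro tendsto_intros)
    moreover have "(\<lambda>k. f (x - y k)) \<longlonglongrightarrow> (\<Sum>k. f (h (y k)))"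
      unfolding fy using summable_LIMSEQ[OF sm] .
    ultimately have "(\<Sum>k. f (h (y k))) = f x" using graph[of "\<lambda>k. x - y k" x] by simp
    moreover have "norm (\<Sum>k. f (h (y k))) \<le> (\<Sum>k. (C * norm x) * (1/2) ^ k)"
      by (rule norm_suminf_le[OF le sums_summable[OF geo]])
    ultimately show "norm (f x) \<le> norm x * (2 * C)"
      using sums_unique[OF geo] by (simp add: mult_ac)
  qed (simp_all add: linear_add[OF lin] linear_scale[OF lin])
qed

section \<open>Orthogonal projection, Riesz representation and adjoints in real Hilbert
  spaces\<close>

lemma orthogonal_projection_exists:
  fixes V :: "'a::{real_inner,banach} set"
  assumes V: "subspace V" "closed V"
  shows "\<exists>p\<in>V. \<forall>v\<in>V. inner (x - p) v = 0"
proof -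
  define D where "D = (INF v\<in>V. (norm (x - v))\<^sup>2)"
  have bdd: "bdd_below ((\<lambda>v. (norm (x - v))\<^sup>2) ` V)"
    by (rule bdd_belowI[of _ 0]) auto
  have ne: "V \<noteq> {}" using subspace_0[OF V(1)] by auto
  have D: "D \<le> (norm (x - v))\<^sup>2" if "v \<in> V" for v
    unfolding D_def by (rule cINF_lower[OF bdd that])
  have "\<exists>v\<in>V. (norm (x - v))\<^sup>2 < D + 1 / real (Suc n)" for n
    using cINF_less_iff[OF ne bdd, of "D + 1 / real (Suc n)"] by (simp add: D_def)
  then obtain v where v: "\<And>n. v n \<in> V" "\<And>n. (norm (x - v n))\<^sup>2 < D + 1 / real (Suc n)"
    by metis
  have dist: "(norm (v m - v n))\<^sup>2 \<le> 2 / real (Suc m) + 2 / real (Suc n)" for m n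
  proof -
    have "(1/2) *\<^sub>R (v m + v n) \<in> V"
      using V(1) v(1) by (simp add: subspace_add subspace_scale)
    note D[OF this]
    \<comment> \<open>Parallelogram law: the midpoint of \<open>v m\<close> and \<open>v n\<close>
      lies in \<open>V\<close>, so its distance to \<open>x\<close> is bounded below by
      \<open>D\<close>, which forces the minimizing sequence to be Cauchy.\<close>
    moreover have "(norm (v m - v n))\<^sup>2 + 4 * (norm (x - (1/2) *\<^sub>R (v m + v n)))\<^sup>2 =
        2 * (norm (x - v m))\<^sup>2 + 2 * (norm (x - v n))\<^sup>2"
      by (simp add: power2_norm_eq_inner inner_simps inner_commute field_simps)
    ultimately show ?thesis using v(2)[of m] v(2)[of n] by simp
  qed
  have "Cauchy v"
  proof (rule CauchyI)
    fix e :: real assume e: "e > 0"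
    obtain N where N: "4 / e\<^sup>2 < real N" using reals_Archimedean2 by blast
    hence N4: "4 / real (Suc N) < e\<^sup>2"
      using e by (simp add: field_simps) (smt (verit) mult_nonneg_nonneg zero_le_power2)
    have "norm (v m - v n) < e" if "m \<ge> N" "n \<ge> N" for m n
    proof -
      have "2 / real (Suc m) \<le> 2 / real (Suc N)" "2 / real (Suc n) \<le> 2 / real (Suc N)"
        using that by (simp_all add: field_simps)
      hence "(norm (v m - v n))\<^sup>2 < e\<^sup>2" using dist[of m n] N4 by simp
      thus ?thesis using e by (simp add: power_less_imp_less_base)
    qed
    thus "\<exists>M. \<forall>m\<ge>M. \<forall>n\<ge>M. norm (v m - v n) < e" by blast
  qed
  then obtain p where p: "v \<longlonglongrightarrow> p"
    using Cauchy_convergent convergent_def by blast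
  have pV: "p \<in> V" using V(2) v(1) p by (rule closed_sequentially)
  have "(norm (x - p))\<^sup>2 \<le> D"
  proof (rule LIMSEQ_le)
    show "(\<lambda>n. (norm (x - v n))\<^sup>2) \<longlonglongrightarrow> (norm (x - p))\<^sup>2" by (intro tendsto_intros p)
    show "(\<lambda>n. D + 1 / real (Suc n)) \<longlonglongrightarrow> D"
      using tendsto_add[OF tendsto_const LIMSEQ_Suc[OF lim_1_over_n]] by (simp del: of_nat_Suc)
    show "\<exists>N. \<forall>n\<ge>N. (norm (x - v n))\<^sup>2 \<le> D + 1 / real (Suc n)"
      using v(2) less_imp_le by blast
  qed
  hence min: "(norm (x - p))\<^sup>2 \<le> (norm (x - w))\<^sup>2" if "w \<in> V" for w
    using D[OF that] by linarith
  have "inner (x - p) w = 0" if w: "w \<in> V" for w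
  proof (cases "w = 0")
    case False
    \<comment> \<open>First-order optimality: this \<open>t\<close> minimizes the distance from
      \<open>x\<close> to the line \<open>p + t *\<^sub>R w\<close>, and it could only improve on
      the minimizer \<open>p\<close>.\<close>
    define t where "t = inner (x - p) w / inner w w"
    have "p + t *\<^sub>R w \<in> V" using V(1) pV w by (simp add: subspace_add subspace_scale)
    from min[OF this] have "2 * t * inner (x - p) w \<le> t * t * inner w w"
      by (simp add: power2_norm_eq_inner inner_simps inner_commute algebra_simps)
    moreover have "t * inner w w = inner (x - p) w" using False by (simp add: t_def)
    ultimately have "t * inner (x - p) w \<le> 0"
      by (simp add: mult.assoc)
    hence "(inner (x - p) w)\<^sup>2 / inner w w \<le> 0" by (simp add: t_def power2_eq_square)
    moreover have "inner w w > 0" using False by simp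
    ultimately show ?thesis by (simp add: divide_le_0_iff)
  qed simp
  with pV show ?thesis by blast
qed

definition oproj :: "'a::{real_inner,banach} set \<Rightarrow> 'a \<Rightarrow> 'a"
  where "oproj V x = (SOME p. p \<in> V \<and> (\<forall>v\<in>V. inner (x - p) v = 0))"

context
  fixes V :: "'a::{real_inner,banach} set"
  assumes V: "subspace V" "closed V"
begin

lemma oproj_in: "oproj V x \<in> V"
  and oproj_orth: "v \<in> V \<Longrightarrow> inner (x - oproj V x) v = 0"
proof -
  have "\<exists>p. p \<in> V \<and> (\<forall>v\<in>V. inner (x - p) v = 0)"
    using orthogonal_projection_exists[OF V] by blast
  from someI_ex[OF this, folded oproj_def]
  show "oproj V x \<in> V" "v \<in> V \<Longrightarrow> inner (x - oproj V x) v = 0" by blast+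
qed

lemma oproj_unique:
  assumes "p \<in> V" "\<And>v. v \<in> V \<Longrightarrow> inner (x - p) v = 0"
  shows "oproj V x = p"
proof -
  have d: "oproj V x - p \<in> V" using V(1) oproj_in assms(1) by (rule subspace_diff)
  have "inner (oproj V x - p) (oproj V x - p) =
      inner (x - p) (oproj V x - p) - inner (x - oproj V x) (oproj V x - p)"
    by (simp add: inner_simps)
  also have "\<dots> = 0" using assms(2)[OF d] oproj_orth[OF d] by simp
  finally show ?thesis by simp
qed

lemma oproj_orth_left: "v \<in> V \<Longrightarrow> inner v (x - oproj V x) = 0"
  by (subst inner_commute) (rule oproj_orth)

lemma oproj_ident: "x \<in> V \<Longrightarrow> oproj V x = x"
  by (rule oproj_unique) simp_all

lemma bounded_linear_oproj: "bounded_linear (oproj V)"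
proof (rule bounded_linear_intro[where K = 1])
  fix x y r
  show "oproj V (x + y) = oproj V x + oproj V y"
  proof (rule oproj_unique)
    fix v assume "v \<in> V"
    thus "inner (x + y - (oproj V x + oproj V y)) v = 0"
      using oproj_orth[of v x] oproj_orth[of v y] by (simp add: inner_simps)
  qed (simp add: oproj_in V subspace_add)
  show "oproj V (r *\<^sub>R x) = r *\<^sub>R oproj V x"
  proof (rule oproj_unique)
    fix v assume "v \<in> V"
    thus "inner (r *\<^sub>R x - r *\<^sub>R oproj V x) v = 0"
      using oproj_orth[of v x] by (simp add: inner_simps)
  qed (simp add: oproj_in V subspace_scale)
  have "norm (oproj V x) * norm (oproj V x) = inner x (oproj V x)"
    using oproj_orth[OF oproj_in, of x x]
    by (simp add: inner_simps power2_norm_eq_inner flip: power2_eq_square)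
  also have "\<dots> \<le> norm x * norm (oproj V x)" by (rule norm_cauchy_schwarz)
  finally show "norm (oproj V x) \<le> norm x * 1"
    by (cases "norm (oproj V x) = 0") (simp_all add: mult_le_cancel_right)
qed

end

text \<open>The kernel \<open>V\<close> is a closed hyperplane; the vector sought is a multiple of
  its normal \<open>w\<close>, because every \<open>y\<close> differs from a multiple of
  \<open>w\<close> by an element of \<open>V\<close>.\<close>

lemma riesz_representation:
  fixes f :: "'a::{real_inner,banach} \<Rightarrow> real"
  assumes f: "bounded_linear f"
  shows "\<exists>u. \<forall>x. f x = inner x u"
proof (cases "\<forall>x. f x = 0")
  case True
  thus ?thesis by (intro exI[of _ 0]) simp
next
  case False
  interpret bounded_linear f by fact
  define V where "V = {x. f x = 0}"
  have V: "subspace V" "closed V"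
  proof -
    show "subspace V" by (auto simp: V_def subspace_def add scale zero)
    show "closed V" unfolding V_def
      by (intro closed_Collect_eq continuous_intros continuous_on)
  qed
  obtain x where x: "f x \<noteq> 0" using False by blast
  define w where "w = x - oproj V x"
  have fw: "f w = f x" using oproj_in[OF V, of x] by (simp add: w_def diff V_def)
  have w: "inner w v = 0" if "v \<in> V" for v
    unfolding w_def using that by (rule oproj_orth[OF V])
  have w0: "inner w w \<noteq> 0" using fw x zero by auto
  have "f y = inner y ((f w / inner w w) *\<^sub>R w)" for y
  proof -
    have "y - (f y / f w) *\<^sub>R w \<in> V" using fw x by (simp add: V_def diff scale)
    from w[OF this] have "inner y w = f y / f w * inner w w"
      by (simp add: inner_simps inner_commute)
    thus ?thesis using w0 fw x by simp
  qed
  thus ?thesis by blast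
qed

lemma real_adjoint_exists:
  fixes T :: "'a::{real_inner,banach} \<Rightarrow>\<^sub>L 'b::real_inner"
  shows "\<exists>T' :: 'b \<Rightarrow>\<^sub>L 'a. \<forall>x y. inner (T x) y = inner x (T' y)"
proof -
  have "\<exists>u. \<forall>x. inner (T x) y = inner x u" for y
    by (intro riesz_representation bounded_linear_intros)
  then obtain g where g: "\<And>x y. inner (T x) y = inner x (g y)" by metis
  have "bounded_linear g"
  proof (rule bounded_linear_intro[where K = "norm T"])
    fix y z r
    show "g (y + z) = g y + g z" "g (r *\<^sub>R y) = r *\<^sub>R g y"
      by (rule vector_eq_ldot[THEN iffD1]; simp add: inner_simps flip: g)+
    have "norm (g y) * norm (g y) = inner (T (g y)) y"
      by (simp add: g power2_norm_eq_inner flip: power2_eq_square)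
    also have "\<dots> \<le> norm (T (g y)) * norm y" by (rule norm_cauchy_schwarz)
    also have "\<dots> \<le> norm T * norm (g y) * norm y"
      by (intro mult_right_mono norm_blinfun norm_ge_zero)
    finally show "norm (g y) \<le> norm y * norm T"
      by (cases "norm (g y) = 0") (simp_all add: mult_le_cancel_left mult_ac)
  qed
  thus ?thesis using g by (intro exI[of _ "Blinfun g"]) (simp add: bounded_linear_Blinfun_apply)
qed

section \<open>Compact perturbations of Fredholm operators\<close>

definition compact_map :: "('a::real_normed_vector \<Rightarrow>\<^sub>L 'b::real_normed_vector) \<Rightarrow> bool"
  where "compact_map T \<longleftrightarrow> compact (closure (T ` cball 0 1))"

lemma compact_mapI:
  assumes "compact C" "\<And>x. norm x \<le> 1 \<Longrightarrow> blinfun_apply T x \<in> C"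
  shows "compact_map T"
proof -
  have "closure (T ` cball 0 1) \<subseteq> C"
    using assms by (intro closure_minimal compact_imp_closed) auto
  with assms(1) show ?thesis
    unfolding compact_map_def by (metis closed_closure compact_Int_closed inf.absorb2)
qed

lemma compact_mapD: "compact_map T \<Longrightarrow> norm x \<le> 1 \<Longrightarrow> blinfun_apply T x \<in> closure (T ` cball 0 1)"
  using closure_subset[of "T ` cball 0 1"] by auto

lemma compact_map_zero [simp]: "compact_map 0"
  by (rule compact_mapI[of "{0}"]) auto

lemma compact_map_add:
  assumes "compact_map S" "compact_map T"
  shows "compact_map (S + T)"
proof (rule compact_mapI)
  show "compact {x + y |x y. x \<in> closure (S ` cball 0 1) \<and> y \<in> closure (T ` cball 0 1)}"
    using assms unfolding compact_map_def by (rule compact_sums)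
qed (use compact_mapD[OF assms(1)] compact_mapD[OF assms(2)] in \<open>auto simp: blinfun.add_left\<close>)

lemma compact_map_compose_left:
  assumes "compact_map T"
  shows "compact_map (S o\<^sub>L T)"
proof (rule compact_mapI)
  show "compact (S ` closure (T ` cball 0 1))"
    using assms unfolding compact_map_def
    by (intro compact_continuous_image continuous_intros)
qed (use compact_mapD[OF assms] in auto)

lemma compact_map_compose_right:
  assumes "compact_map T"
  shows "compact_map (T o\<^sub>L S)"
proof (rule compact_mapI)
  \<comment> \<open>\<open>S\<close> maps the unit ball into the ball of radius
    \<open>norm S\<close>; the added 1 keeps the scaling factor invertible when \<open>S\<close> is
    zero.\<close>
  show "compact ((\<lambda>y. (norm S + 1) *\<^sub>R y) ` closure (T ` cball 0 1))"
    using assms unfolding compact_map_def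
    by (intro compact_continuous_image continuous_intros)
next
  fix x :: 'c assume x: "norm x \<le> 1"
  have "norm (S x) \<le> norm S * 1"
    using norm_blinfun[of S x] mult_left_mono[OF x norm_ge_zero[of S]] by linarith
  hence "norm ((1 / (norm S + 1)) *\<^sub>R S x) \<le> 1"
    by (simp add: divide_le_eq add_nonneg_pos)
  from compact_mapD[OF assms this]
  have "T ((1 / (norm S + 1)) *\<^sub>R S x) \<in> closure (T ` cball 0 1)" .
  moreover have "(T o\<^sub>L S) x = (norm S + 1) *\<^sub>R T ((1 / (norm S + 1)) *\<^sub>R S x)"
    by (simp add: blinfun.scaleR_right add_nonneg_eq_0_iff)
  ultimately show "(T o\<^sub>L S) x \<in> (\<lambda>y. (norm S + 1) *\<^sub>R y) ` closure (T ` cball 0 1)"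
    by blast
qed

lemma compact_map_minus:
  assumes "compact_map T"
  shows "compact_map (- T)"
proof -
  have "- T = - id_blinfun o\<^sub>L T" by (rule blinfun_eqI) (simp add: blinfun.minus_left)
  thus ?thesis using compact_map_compose_left[OF assms] by simp
qed

text \<open>The operator factors through the real line, where the closed unit ball is
  compact.\<close>

lemma compact_map_rank_one: "compact_map (blinfun_scaleR_left e o\<^sub>L f)"
proof (rule compact_map_compose_right, rule compact_mapI)
  show "compact ((\<lambda>r. r *\<^sub>R e) ` cball 0 1)"
    by (intro compact_continuous_image continuous_intros) auto
qed auto

text \<open>Total boundedness survives uniform approximation on the unit ball: a finite net for the
  image under a nearby compact \<open>S\<close> is also a net, with larger radius, for the image
  under \<open>T\<close>.\<close>

lemma compact_map_approx:
  fixes T :: "'a::real_normed_vector \<Rightarrow>\<^sub>L 'b::banach"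
  assumes "\<And>e. e > 0 \<Longrightarrow> \<exists>S. compact_map S \<and> norm (S - T) < e"
  shows "compact_map T"
  unfolding compact_map_def compact_eq_totally_bounded
proof (intro conjI allI impI)
  show "complete (closure (T ` cball 0 1))" by (simp add: complete_eq_closed)
next
  fix e :: real assume e: "e > 0"
  obtain S where S: "compact_map S" "norm (S - T) < e / 4"
    using assms[of "e / 4"] e by auto
  obtain k where k: "finite k" "closure (S ` cball 0 1) \<subseteq> (\<Union>x\<in>k. ball x (e / 4))"
    using S(1) e unfolding compact_map_def compact_eq_totally_bounded
    by (metis divide_pos_pos zero_less_numeral)
  \<comment> \<open>Closed balls are used here since their finite union is closed and hence contains
    the closure of the image; radius \<open>e / 2\<close> leaves room to return to open balls of
    radius \<open>e\<close>.\<close>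
  have "T ` cball 0 1 \<subseteq> (\<Union>x\<in>k. cball x (e / 2))"
  proof clarify
    fix x :: 'a assume "x \<in> cball 0 1"
    hence x: "norm x \<le> 1" by simp
    from compact_mapD[OF S(1) this] k(2) obtain y where y: "y \<in> k" "dist y (S x) < e / 4"
      by auto
    have "norm ((S - T) x) \<le> norm (S - T) * 1"
      using norm_blinfun[of "S - T" x] mult_left_mono[OF x norm_ge_zero[of "S - T"]] by linarith
    hence "dist (S x) (T x) < e / 4" using S(2) by (simp add: dist_norm blinfun.diff_left)
    hence "dist y (T x) \<le> e / 2"
      using y(2) dist_triangle[of y "T x" "S x"] by linarith
    thus "T x \<in> (\<Union>x\<in>k. cball x (e / 2))" using y(1) by auto
  qed
  hence "closure (T ` cball 0 1) \<subseteq> (\<Union>x\<in>k. cball x (e / 2))"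
    using k(1) by (intro closure_minimal closed_UN) auto
  also have "\<dots> \<subseteq> (\<Union>x\<in>k. ball x e)" using e by auto
  finally show "\<exists>k. finite k \<and> closure (T ` cball 0 1) \<subseteq> (\<Union>x\<in>k. ball x e)"
    using k(1) by blast
qed

lemma compact_map_subseq:
  assumes "compact_map T" "\<And>n :: nat. norm (x n) \<le> 1"
  shows "\<exists>l r. strict_mono (r :: nat \<Rightarrow> nat) \<and> (\<lambda>n. blinfun_apply T (x (r n))) \<longlonglongrightarrow> l"
proof -
  have "seq_compact (closure (T ` cball 0 1))"
    using assms(1) unfolding compact_map_def by (rule compact_imp_seq_compact)
  moreover have "\<forall>n. (\<lambda>n. T (x n)) n \<in> closure (T ` cball 0 1)"
    using compact_mapD[OF assms(1)] assms(2) by simp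
  ultimately obtain l r where "strict_mono r" "((\<lambda>n. T (x n)) \<circ> r) \<longlonglongrightarrow> l"
    by (rule seq_compactE)
  thus ?thesis by (auto simp: o_def)
qed

section \<open>Finite dimension and closed range by compactness\<close>

definition fin_dim :: "'a::real_vector set \<Rightarrow> bool"
  where "fin_dim V \<longleftrightarrow> (\<exists>b. finite b \<and> V \<subseteq> span b)"

text \<open>Gram-Schmidt by induction on \<open>b\<close>: a new vector \<open>a\<close> contributes
  the rank-one projection onto the direction of its component orthogonal to the span of
  \<open>b\<close>. Finite rank gives compactness.\<close>

lemma projection_on_finite_span:
  fixes b :: "'a::real_inner set"
  assumes "finite b"
  shows "\<exists>P :: 'a \<Rightarrow>\<^sub>L 'a. compact_map P \<and> (\<forall>x. P x \<in> span b \<and> (\<forall>v\<in>span b. inner (x - P x) v = 0))"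
  using assms
proof (induction b)
  case empty
  show ?case by (rule exI[of _ 0]) simp
next
  case (insert a b)
  then obtain P :: "'a \<Rightarrow>\<^sub>L 'a" where P: "compact_map P" "\<And>x. P x \<in> span b"
    "\<And>x v. v \<in> span b \<Longrightarrow> inner (x - P x) v = 0"
    by blast
  \<comment> \<open>If \<open>a\<close> already lies in the span of \<open>b\<close>, then
    \<open>e = sgn 0 = 0\<close> and \<open>Q = P\<close>, so this case needs no separate
    treatment.\<close>
  define e where "e = sgn (a - P a)"
  define Q where "Q = P + (blinfun_scaleR_left e o\<^sub>L blinfun_inner_left e)"
  have Qx: "Q x = P x + inner x e *\<^sub>R e" for x
    by (simp add: Q_def blinfun.add_left)
  have eo: "inner e v = 0" if "v \<in> span b" for v
    using P(3)[OF that, of a] by (simp add: e_def sgn_div_norm)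
  have sub: "span b \<subseteq> span (insert a b)" by (intro span_mono) auto
  have es: "e \<in> span (insert a b)"
    unfolding e_def sgn_div_norm using sub P(2)[of a]
    by (intro span_scale span_diff) (auto intro: span_base)
  have ae: "a = P a + norm (a - P a) *\<^sub>R e"
    by (cases "a = P a") (simp_all add: e_def sgn_div_norm)
  have ne: "norm (a - P a) * inner e e = norm (a - P a)"
    by (cases "a = P a") (simp_all add: e_def norm_sgn flip: power2_norm_eq_inner)
  have "inner (x - Q x) v = 0" if "v \<in> span (insert a b)" for x v
  proof -
    from that obtain k where k: "v - k *\<^sub>R a \<in> span b" by (auto simp: span_insert)
    define w where "w = v - k *\<^sub>R a + k *\<^sub>R P a"
    have w: "w \<in> span b" unfolding w_def using k P(2) by (intro span_add span_scale)
    have v: "v = w + (k * norm (a - P a)) *\<^sub>R e"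
      using arg_cong[OF ae, of "(*\<^sub>R) k"] by (simp add: w_def algebra_simps)
    have "inner (P x) e = 0" using eo[OF P(2)[of x]] by (simp add: inner_commute)
    hence "norm (a - P a) * inner (x - Q x) e = 0"
      using ne by (simp add: Qx inner_simps algebra_simps)
    moreover have "inner (x - Q x) w = 0"
      using P(3)[OF w, of x] eo[OF w] by (simp add: Qx inner_simps)
    ultimately show ?thesis unfolding v by (auto simp: inner_simps)
  qed
  moreover have "compact_map Q"
    unfolding Q_def by (intro compact_map_add P compact_map_rank_one)
  moreover have "Q x \<in> span (insert a b)" for x
    unfolding Qx using P(2)[of x] sub es by (intro span_add span_scale) auto
  ultimately show ?case by blast
qed

text \<open>The span of the finitely many vectors already chosen cannot contain \<open>V\<close>.
  Some vector of \<open>V\<close> thus has a nonzero component orthogonal to that span, and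
  normalizing it yields the next member.\<close>

lemma orthonormal_sequence:
  fixes V :: "'a::real_inner set"
  assumes V: "subspace V" "\<not> fin_dim V"
  shows "\<exists>e :: nat \<Rightarrow> 'a. (\<forall>n. e n \<in> V \<and> norm (e n) = 1) \<and> (\<forall>m n. m < n \<longrightarrow> inner (e m) (e n) = 0)"
proof -
  define Q :: "(nat \<Rightarrow> 'a) \<Rightarrow> nat \<Rightarrow> 'a \<Rightarrow> bool" where
    "Q f n x \<longleftrightarrow> x \<in> V \<and> norm x = 1 \<and> (\<forall>m<n. inner (f m) x = 0)" for f n x
  have "\<exists>f. \<forall>n. Q f n (f n)"
  proof (rule dependent_wellorder_choice)
    fix r :: 'a and f g :: "nat \<Rightarrow> 'a" and n assume "\<And>m. m < n \<Longrightarrow> f m = g m"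
    thus "Q f n r = Q g n r" by (simp add: Q_def)
  next
    fix n and f :: "nat \<Rightarrow> 'a" assume f: "\<And>m. m < n \<Longrightarrow> Q f m (f m)"
    have fin: "finite (f ` {..<n})" by simp
    have sub: "span (f ` {..<n}) \<subseteq> V"
      using f by (intro span_minimal V) (auto simp: Q_def)
    obtain P :: "'a \<Rightarrow>\<^sub>L 'a" where P: "\<And>x. P x \<in> span (f ` {..<n})"
      "\<And>x v. v \<in> span (f ` {..<n}) \<Longrightarrow> inner (x - P x) v = 0"
      using projection_on_finite_span[OF fin] by blast
    obtain x where x: "x \<in> V" "x \<notin> span (f ` {..<n})"
      using V(2) fin unfolding fin_dim_def by blast
    define y where "y = x - P x"
    have "y \<noteq> 0" using x P(1)[of x] by (auto simp: y_def)
    moreover have "y \<in> V" unfolding y_def using V(1) x(1) P(1)[of x] sub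
      by (intro subspace_diff) auto
    moreover have "inner (f m) y = 0" if "m < n" for m
      unfolding y_def using that by (subst inner_commute, intro P(2) span_base) auto
    ultimately have "Q f n (sgn y)"
      by (simp add: Q_def norm_sgn) (simp add: sgn_div_norm subspace_scale V)
    thus "\<exists>r. Q f n r" by blast
  qed
  thus ?thesis by (auto simp: Q_def)
qed

text \<open>
  On an orthonormal sequence \<open>e\<close> in \<open>V\<close> the hypothesis gives
  \<open>inner (e m) (K (e m)) = -1\<close> and \<open>inner (e m) (K (e n)) = 0\<close>, so that the
  \<open>K (e n)\<close> stay at mutual distance at least 1. The lemma covers both the kernel of an operator
  with a left parametrix and the orthogonal complement of the range of one with a right parametrix.
\<close>

lemma fin_dim_of_id_plus_compact:
  fixes K :: "'a::real_inner \<Rightarrow>\<^sub>L 'a"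
  assumes V: "subspace V" and K: "compact_map K"
    and orth: "\<And>v w. v \<in> V \<Longrightarrow> w \<in> V \<Longrightarrow> inner v (w + K w) = 0"
  shows "fin_dim V"
proof (rule ccontr)
  assume "\<not> fin_dim V"
  from orthonormal_sequence[OF V this] obtain e :: "nat \<Rightarrow> 'a" where
    e: "\<And>n. e n \<in> V" "\<And>n. norm (e n) = 1" "\<And>m n. m < n \<Longrightarrow> inner (e m) (e n) = 0"
    by blast
  obtain l r where r: "strict_mono (r :: nat \<Rightarrow> nat)" "(\<lambda>n. K (e (r n))) \<longlonglongrightarrow> l"
    using compact_map_subseq[OF K, of e] e(2) by auto
  from LIMSEQ_imp_Cauchy[OF r(2)] obtain N where
    N: "\<And>m n. m \<ge> N \<Longrightarrow> n \<ge> N \<Longrightarrow> norm (K (e (r m)) - K (e (r n))) < 1"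
    unfolding Cauchy_iff by (metis zero_less_one)
  define m n where "m = r N" "n = r (Suc N)"
  have mn: "m < n" using r(1) by (simp add: m_n_def strict_mono_def)
  have "inner (e m) (K (e m)) = - 1"
    using orth[of "e m" "e m"] e(1,2) by (simp add: inner_simps flip: power2_norm_eq_inner)
  moreover have "inner (e m) (K (e n)) = 0"
    using orth[of "e m" "e n"] e(1) e(3)[OF mn] by (simp add: inner_simps)
  ultimately have "1 = \<bar>inner (e m) (K (e m) - K (e n))\<bar>" by (simp add: inner_simps)
  also have "\<dots> \<le> norm (e m) * norm (K (e m) - K (e n))" by (rule Cauchy_Schwarz_ineq2)
  also have "\<dots> < 1" using N[of N "Suc N"] e(2) by (simp add: m_n_def)
  finally show False by simp
qed

text \<open>On the orthogonal complement \<open>M\<close> of the kernel, \<open>T\<close> has the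
  same range and is bounded below: otherwise unit vectors of \<open>M\<close> with images tending to
  0 would accumulate at a unit vector lying both in \<open>M\<close> and in the kernel. The lower
  bound keeps the preimages in \<open>M\<close> of a convergent sequence bounded, and a limit point
  of them is a preimage of the limit.\<close>

lemma closed_range_left_parametrix:
  fixes T :: "'a::{real_inner,banach} \<Rightarrow>\<^sub>L 'b::banach" and S :: "'b \<Rightarrow>\<^sub>L 'a"
  assumes K: "compact_map K" and S: "\<And>x. S (T x) = x + blinfun_apply K x"
  shows "closed (range T)"
proof -
  define N where "N = {x. T x = 0}"
  have N: "subspace N" "closed N"
  proof -
    show "subspace N" by (auto simp: N_def subspace_def blinfun.add_right blinfun.scaleR_right)
    show "closed N" unfolding N_def by (intro closed_Collect_eq continuous_intros)
  qed
  define M where "M = {x. \<forall>v\<in>N. inner x v = 0}"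
  have M: "closed M" "subspace M"
  proof -
    have "M = (\<Inter>v\<in>N. {x. inner x v = 0})" by (auto simp: M_def)
    thus "closed M" by (auto intro!: closed_Collect_eq continuous_intros)
    show "subspace M" by (auto simp: M_def subspace_def inner_simps)
  qed
  \<comment> \<open>Since \<open>x n = S (T (x n)) - K (x n)\<close> and the first term converges,
    \<open>x n\<close> converges along every subsequence along which \<open>K (x n)\<close>
    does.\<close>
  have limit: "\<exists>u r. u \<in> M \<and> strict_mono (r :: nat \<Rightarrow> nat) \<and> (\<lambda>n. x (r n)) \<longlonglongrightarrow> u \<and> T u = y"
    if x: "\<And>n :: nat. norm (x n) \<le> 1" "\<And>n. x n \<in> M" "(\<lambda>n. T (x n)) \<longlonglongrightarrow> y" for x and y :: 'b
  proof -
    obtain l r where r: "strict_mono (r :: nat \<Rightarrow> nat)" "(\<lambda>n. K (x (r n))) \<longlonglongrightarrow> l"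
      using compact_map_subseq[OF K, of x] x(1) by blast
    have Tr: "(\<lambda>n. T (x (r n))) \<longlonglongrightarrow> y"
      using LIMSEQ_subseq_LIMSEQ[OF x(3) r(1)] by (simp add: o_def)
    hence "(\<lambda>n. S (T (x (r n))) - K (x (r n))) \<longlonglongrightarrow> S y - l"
      by (intro tendsto_intros r)
    hence lim: "(\<lambda>n. x (r n)) \<longlonglongrightarrow> S y - l" by (simp add: S)
    have "S y - l \<in> M" using M(1) x(2) lim by (rule closed_sequentially)
    moreover have "(\<lambda>n. T (x (r n))) \<longlonglongrightarrow> T (S y - l)" by (intro tendsto_intros lim)
    with Tr have "T (S y - l) = y" using LIMSEQ_unique by blast
    ultimately show ?thesis using r(1) lim by blast
  qed
  have bound: "\<exists>c>0. \<forall>x\<in>M. c * norm x \<le> norm (T x)"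
  proof (rule ccontr)
    assume neg: "\<not> (\<exists>c>0. \<forall>x\<in>M. c * norm x \<le> norm (T x))"
    have "\<exists>x\<in>M. norm x = 1 \<and> norm (T x) \<le> 1 / real (Suc n)" for n
    proof -
      obtain x where x: "x \<in> M" "norm (T x) < (1 / real (Suc n)) * norm x"
        using neg by (metis not_le of_nat_0_less_iff zero_less_Suc zero_less_divide_1_iff)
      hence "x \<noteq> 0" by auto
      hence "norm (sgn x) = 1" "norm (T (sgn x)) \<le> 1 / real (Suc n)"
        using x(2) by (simp_all add: norm_sgn sgn_div_norm blinfun.scaleR_right divide_simps mult_ac)
      moreover have "sgn x \<in> M" using x(1) M(2) by (simp add: sgn_div_norm subspace_scale)
      ultimately show ?thesis by blast
    qed
    then obtain x where x: "\<And>n. x n \<in> M" "\<And>n. norm (x n) = 1" "\<And>n. norm (T (x n)) \<le> 1 / real (Suc n)"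
      by metis
    have "(\<lambda>n. T (x n)) \<longlonglongrightarrow> 0"
      by (rule Lim_null_comparison[OF _ LIMSEQ_Suc[OF lim_1_over_n]]) (use x(3) in auto)
    then obtain u r where u: "u \<in> M" "strict_mono (r :: nat \<Rightarrow> nat)" "(\<lambda>n. x (r n)) \<longlonglongrightarrow> u" "T u = 0"
      using limit[of x 0] x by auto
    hence "inner u u = 0" by (auto simp: M_def N_def)
    moreover have "(\<lambda>n. norm (x (r n))) \<longlonglongrightarrow> norm u" by (intro tendsto_intros u)
    hence "norm u = 1" using x(2) by (simp add: LIMSEQ_const_iff)
    ultimately show False by simp
  qed
  then obtain c where c: "c > 0" "\<And>x. x \<in> M \<Longrightarrow> c * norm x \<le> norm (T x)" by blast
  show ?thesis
    unfolding closed_sequential_limits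
  proof (intro allI impI, elim conjE)
    fix t y assume t: "\<forall>n. t n \<in> range T" "t \<longlonglongrightarrow> y"
    have "\<exists>x\<in>M. T x = t n" for n
    proof -
      obtain x where x: "t n = T x" using t(1) by blast
      have "x - oproj N x \<in> M" using oproj_orth[OF N] by (simp add: M_def)
      moreover have "T (x - oproj N x) = t n"
        using oproj_in[OF N, of x] by (simp add: N_def blinfun.diff_right x)
      ultimately show ?thesis by blast
    qed
    then obtain x where x: "\<And>n. x n \<in> M" "\<And>n. T (x n) = t n" by metis
    obtain B where B: "B > 0" "\<And>n. norm (t n) \<le> B"
      using convergent_imp_Bseq[of t] t(2) by (auto simp: convergent_def Bseq_def)
    \<comment> \<open>\<open>limit\<close> is stated for sequences in the unit ball, so the
      preimages are scaled by \<open>c / B\<close>; the scaling is undone at the end.\<close>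
    have "norm ((c / B) *\<^sub>R x n) \<le> 1" for n
      using order_trans[OF c(2)[OF x(1)[of n]], of B] B c(1) by (simp add: x(2) field_simps)
    moreover have "(c / B) *\<^sub>R x n \<in> M" for n using M(2) x(1) by (simp add: subspace_scale)
    moreover have "(\<lambda>n. T ((c / B) *\<^sub>R x n)) \<longlonglongrightarrow> (c / B) *\<^sub>R y"
      using t(2) by (simp add: blinfun.scaleR_right x(2) tendsto_intros)
    ultimately obtain u where "T u = (c / B) *\<^sub>R y"
      using limit[of "\<lambda>n. (c / B) *\<^sub>R x n"] by blast
    hence "T ((B / c) *\<^sub>R u) = y" using c B by (simp add: blinfun.scaleR_right)
    thus "y \<in> range T" by blast
  qed
qed

section \<open>Atkinson's characterization of Fredholm operators by parametrices\<close>

definition fredholm_map :: "('a::real_normed_vector \<Rightarrow>\<^sub>L 'b::real_normed_vector) \<Rightarrow> bool"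
  where "fredholm_map T \<longleftrightarrow>
    fin_dim {x. T x = 0} \<and> closed (range T) \<and> (\<exists>b. finite b \<and> span (range T \<union> b) = UNIV)"

text \<open>The parametrix is the Moore-Penrose inverse \<open>g\<close>: project onto the range,
  then take the preimage orthogonal to the kernel. The remainders \<open>K\<close> and
  \<open>L\<close> are minus the orthogonal projections onto the kernel and onto the complement of
  the range, both of finite rank.\<close>

lemma fredholm_map_parametrix:
  fixes T :: "'a::{real_inner,banach} \<Rightarrow>\<^sub>L 'b::{real_inner,banach}"
  assumes "fredholm_map T"
  shows "\<exists>(S :: 'b \<Rightarrow>\<^sub>L 'a) K L. compact_map K \<and> compact_map L \<and>
    (\<forall>x. S (T x) = x + blinfun_apply K x) \<and> (\<forall>y. T (S y) = y + blinfun_apply L y)"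
proof -
  define N where "N = {x. T x = 0}"
  have N: "subspace N" "closed N"
  proof -
    show "subspace N" by (auto simp: N_def subspace_def blinfun.add_right blinfun.scaleR_right)
    show "closed N" unfolding N_def by (intro closed_Collect_eq continuous_intros)
  qed
  have R: "subspace (range T)" "closed (range T)"
    using assms by (auto simp: fredholm_map_def linear_subspace_image bounded_linear.linear blinfun.bounded_linear_right)
  obtain b where b: "finite b" "N \<subseteq> span b" using assms by (auto simp: fredholm_map_def fin_dim_def N_def)
  obtain c where c: "finite c" "span (range T \<union> c) = UNIV" using assms by (auto simp: fredholm_map_def)
  define g where "g y = (SOME x. T x = oproj (range T) y \<and> (\<forall>v\<in>N. inner x v = 0))" for y
  have g: "T (g y) = oproj (range T) y" "\<And>v. v \<in> N \<Longrightarrow> inner (g y) v = 0" for y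
  proof -
    obtain x where x: "oproj (range T) y = T x" using oproj_in[OF R, of y] by blast
    have "T (x - oproj N x) = oproj (range T) y"
      using oproj_in[OF N, of x] by (simp add: N_def blinfun.diff_right x)
    moreover have "\<forall>v\<in>N. inner (x - oproj N x) v = 0" using oproj_orth[OF N] by blast
    ultimately have "\<exists>x. T x = oproj (range T) y \<and> (\<forall>v\<in>N. inner x v = 0)" by blast
    from someI_ex[OF this, folded g_def]
    show "T (g y) = oproj (range T) y" "\<And>v. v \<in> N \<Longrightarrow> inner (g y) v = 0" by blast+
  qed
  have g_eq: "g y = x" if "T x = oproj (range T) y" "\<And>v. v \<in> N \<Longrightarrow> inner x v = 0" for x y
  proof -
    have "g y - x \<in> N" using that g by (simp add: N_def blinfun.diff_right)
    hence "inner (g y - x) (g y - x) = 0" using that(2) g(2)[of _ y] by (simp add: inner_diff_left)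
    thus ?thesis by simp
  qed
  interpret pr: bounded_linear "oproj (range T)" by (rule bounded_linear_oproj[OF R])
  \<comment> \<open>\<open>g_eq\<close> characterizes \<open>g y\<close> by two conditions that are
    preserved under limits, so the graph of \<open>g\<close> is closed.\<close>
  have "bounded_linear g"
  proof (rule closed_graph_bounded_linear)
    show "linear g"
    proof
      fix x y r
      show "g (x + y) = g x + g y" "g (r *\<^sub>R x) = r *\<^sub>R g x"
        by (rule g_eq; simp add: g pr.add pr.scale blinfun.add_right blinfun.scaleR_right inner_simps)+
    qed
  next
    fix Y y x assume Y: "Y \<longlonglongrightarrow> y" "(\<lambda>n. g (Y n)) \<longlonglongrightarrow> x"
    have "(\<lambda>n. T (g (Y n))) \<longlonglongrightarrow> T x" by (intro tendsto_intros Y)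
    moreover have "(\<lambda>n. T (g (Y n))) \<longlonglongrightarrow> oproj (range T) y"
      unfolding g by (intro pr.tendsto Y)
    ultimately have "T x = oproj (range T) y" using LIMSEQ_unique by blast
    moreover have "inner x v = 0" if "v \<in> N" for v
    proof -
      have "(\<lambda>n. inner (g (Y n)) v) \<longlonglongrightarrow> inner x v" by (intro tendsto_intros Y)
      thus ?thesis using g(2)[OF that] by (simp add: LIMSEQ_const_iff)
    qed
    ultimately show "x = g y" using g_eq by metis
  qed
  hence gB: "Blinfun g y = g y" for y by (simp add: bounded_linear_Blinfun_apply)
  obtain P :: "'a \<Rightarrow>\<^sub>L 'a" where P: "compact_map P" "\<And>x. P x \<in> span b"
    "\<And>x v. v \<in> span b \<Longrightarrow> inner (x - P x) v = 0"
    using projection_on_finite_span[OF b(1)] by blast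
  \<comment> \<open>Compactness is available for the projection \<open>P\<close> onto the span of
    \<open>b\<close>, not directly for the one onto \<open>N\<close>. As \<open>N\<close> lies in
    that span, projecting onto \<open>N\<close> factors through \<open>P\<close>.\<close>
  define K where "K = - (Blinfun (oproj N) o\<^sub>L P)"
  have "compact_map K" unfolding K_def
    by (intro compact_map_minus compact_map_compose_left P)
  moreover have "Blinfun g (T x) = x + K x" for x
  proof -
    have "oproj N x = oproj N (P x)"
    proof (rule oproj_unique[OF N])
      fix v assume "v \<in> N"
      thus "inner (x - oproj N (P x)) v = 0"
        using P(3)[of v x] oproj_orth[OF N, of v "P x"] b(2) by (auto simp: inner_simps)
    qed (rule oproj_in[OF N])
    hence "K x = - oproj N x"
      by (simp add: K_def blinfun.minus_left bounded_linear_Blinfun_apply bounded_linear_oproj N)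
    moreover have "g (T x) = x - oproj N x"
    proof (rule g_eq)
      show "T (x - oproj N x) = oproj (range T) (T x)"
        using oproj_in[OF N, of x] oproj_ident[OF R, of "T x"] by (simp add: N_def blinfun.diff_right)
    qed (rule oproj_orth[OF N])
    ultimately show ?thesis by (simp add: gB)
  qed
  moreover
  define q where "q y = y - oproj (range T) y" for y
  have q: "linear q" unfolding q_def
    by (intro linear_compose_sub bounded_linear.linear bounded_linear_oproj R linear_ident)
  obtain P' :: "'b \<Rightarrow>\<^sub>L 'b" where P': "compact_map P'" "\<And>x. P' x \<in> span (q ` c)"
    "\<And>x v. v \<in> span (q ` c) \<Longrightarrow> inner (x - P' x) v = 0"
    using projection_on_finite_span[of "q ` c"] c(1) by blast
  have "T (Blinfun g y) = y + (- P') y" for y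
  proof -
    have "range q = q ` span (range T \<union> c)" using c(2) by simp
    also have "\<dots> = span (q ` range T \<union> q ` c)"
      by (simp add: linear_span_image[OF q, symmetric] image_Un)
    also have "\<dots> \<subseteq> span (q ` c)"
    proof (rule span_minimal)
      have "q (T x) = 0" for x using oproj_ident[OF R, of "T x"] by (simp add: q_def)
      thus "q ` range T \<union> q ` c \<subseteq> span (q ` c)" by (auto intro: span_base span_zero)
    qed simp
    finally have qs: "q x \<in> span (q ` c)" for x by blast
    have so: "inner (oproj (range T) y) v = 0" if "v \<in> span (q ` c)" for v
    proof -
      have "span (q ` c) \<subseteq> {v. inner (oproj (range T) y) v = 0}"
      proof (rule span_minimal)
        show "q ` c \<subseteq> {v. inner (oproj (range T) y) v = 0}"
          using oproj_orth_left[OF R oproj_in[OF R]] by (auto simp: q_def)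
      qed (auto simp: subspace_def inner_simps)
      thus ?thesis using that by blast
    qed
    have d: "q y - P' y \<in> span (q ` c)" using qs P'(2) by (rule span_diff)
    have "inner (q y - P' y) (q y - P' y) =
        inner (y - P' y) (q y - P' y) - inner (oproj (range T) y) (q y - P' y)"
      by (simp add: q_def inner_simps)
    also have "\<dots> = 0" using P'(3)[OF d] so[OF d] by simp
    finally have "q y = P' y" by simp
    thus ?thesis by (simp add: gB g q_def blinfun.minus_left) (metis add_diff_cancel_left' diff_add_cancel)
  qed
  moreover have "compact_map (- P')" by (intro compact_map_minus P')
  ultimately show ?thesis by blast
qed

text \<open>The left remainder \<open>K\<close> controls the kernel and makes the range closed; the
  right remainder \<open>L\<close> controls the orthogonal complement \<open>W\<close> of the range.
  Closedness allows projecting onto the range, so a finite set spanning \<open>W\<close> completes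
  it to the whole space.\<close>

lemma fredholm_map_of_parametrix:
  fixes T :: "'a::{real_inner,banach} \<Rightarrow>\<^sub>L 'b::{real_inner,banach}" and S :: "'b \<Rightarrow>\<^sub>L 'a"
  assumes K: "compact_map K" "\<And>x. S (T x) = x + blinfun_apply K x"
    and L: "compact_map L" "\<And>y. T (S y) = y + blinfun_apply L y"
  shows "fredholm_map T"
proof -
  have R: "subspace (range T)" "closed (range T)"
    using closed_range_left_parametrix[OF K]
    by (simp_all add: linear_subspace_image bounded_linear.linear blinfun.bounded_linear_right)
  have "fin_dim {x. T x = 0}"
  proof (rule fin_dim_of_id_plus_compact[OF _ K(1)])
    show "subspace {x. T x = 0}"
      by (auto simp: subspace_def blinfun.add_right blinfun.scaleR_right)
    show "inner v (w + K w) = 0" if "w \<in> {x. T x = 0}" for v w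
      using that K(2)[of w, symmetric] by simp
  qed
  moreover have "\<exists>b. finite b \<and> span (range T \<union> b) = UNIV"
  proof -
    define W where "W = {w. \<forall>v\<in>range T. inner w v = 0}"
    have "fin_dim W"
    proof (rule fin_dim_of_id_plus_compact[OF _ L(1)])
      show "subspace W" by (auto simp: W_def subspace_def inner_simps)
      show "inner v (w + L w) = 0" if "v \<in> W" for v w
        using that by (simp add: W_def flip: L(2))
    qed
    then obtain b where b: "finite b" "W \<subseteq> span b" by (auto simp: fin_dim_def)
    have "y \<in> span (range T \<union> b)" for y
    proof -
      have "y - oproj (range T) y \<in> W" using oproj_orth[OF R] by (simp add: W_def)
      hence "y - oproj (range T) y \<in> span (range T \<union> b)"
        using b(2) span_mono[of b "range T \<union> b"] by auto
      moreover have "oproj (range T) y \<in> span (range T \<union> b)"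
        using oproj_in[OF R, of y] by (intro span_base) simp
      ultimately show ?thesis using span_add by fastforce
    qed
    thus ?thesis using b(1) by blast
  qed
  ultimately show ?thesis using R(2) by (simp add: fredholm_map_def)
qed

text \<open>A parametrix \<open>S\<close> of \<open>T\<close> is also one of \<open>T + C\<close>:
  the remainders only gain the compact terms \<open>S o\<^sub>L C\<close> and
  \<open>C o\<^sub>L S\<close>.\<close>

theorem fredholm_map_add_compact:
  fixes T :: "'a::{real_inner,banach} \<Rightarrow>\<^sub>L 'b::{real_inner,banach}"
  assumes T: "fredholm_map T" and C: "compact_map C"
  shows "fredholm_map (T + C)"
proof -
  obtain S :: "'b \<Rightarrow>\<^sub>L 'a" and K L where S: "compact_map K" "compact_map L"
    "\<And>x. S (T x) = x + K x" "\<And>y. T (S y) = y + L y"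
    using fredholm_map_parametrix[OF T] by blast
  show ?thesis
  proof (rule fredholm_map_of_parametrix)
    show "S ((T + C) x) = x + (K + (S o\<^sub>L C)) x" for x
      by (simp add: blinfun.add_left blinfun.add_right S(3))
    show "(T + C) (S y) = y + (L + (C o\<^sub>L S)) y" for y
      by (simp add: blinfun.add_left S(4))
  qed (intro compact_map_add compact_map_compose_left compact_map_compose_right S C)+
qed

section \<open>Resolvents and their extensions\<close>

lemma complex_subspace_imp_subspace: "complex_vector.subspace V \<Longrightarrow> subspace V"
  by (simp add: complex_vector.subspace_def subspace_def scaleR_scaleC)

lemma scaleC_diff_right: "c *\<^sub>C (x - y) = c *\<^sub>C x - c *\<^sub>C (y :: 'a :: complex_vector)"
  by (rule complex_vector.scale_right_diff_distrib)

lemma scaleC_minus_one: "(- 1) *\<^sub>C x = - (x :: 'a :: complex_vector)"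
  by (metis complex_vector.scale_minus_left scaleC_one)

lemma scaleC_Re_Im: "c *\<^sub>C x = Re c *\<^sub>R x + Im c *\<^sub>R \<i> *\<^sub>C (x :: 'a :: complex_vector)"
proof -
  have "c *\<^sub>C x = (complex_of_real (Re c) + complex_of_real (Im c) * \<i>) *\<^sub>C x"
    by (subst complex_eq) (simp add: mult.commute)
  thus ?thesis by (simp only: scaleC_add_left scaleR_scaleC scaleC_scaleC)
qed

lemma linear_scaleC: "linear (\<lambda>x :: 'a :: complex_vector. c *\<^sub>C x)"
  by (rule linearI) (simp_all add: scaleC_add_right scaleC_scaleR_commute)

text \<open>Multiplication by \<i> permutes the generators on the right up to sign, so their real
  span is a complex subspace. Finite spanning sets over the complex numbers thereby become finite
  ones over the reals.\<close>

lemma complex_span_eq_span: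
  "complex_vector.span b = span (b \<union> (\<lambda>x. \<i> *\<^sub>C x) ` (b :: 'a :: complex_vector set))"
  (is "?L = span ?X")
proof
  have ii: "\<i> *\<^sub>C x \<in> span ?X" if "x \<in> span ?X" for x
  proof -
    have "\<i> *\<^sub>C x \<in> (\<lambda>x. \<i> *\<^sub>C x) ` span ?X" using that by blast
    also have "\<dots> = span ((\<lambda>x. \<i> *\<^sub>C x) ` ?X)"
      by (rule linear_span_image[OF linear_scaleC, symmetric])
    also have "\<dots> \<subseteq> span ?X"
    proof (rule span_minimal)
      have "\<i> *\<^sub>C \<i> *\<^sub>C y \<in> span ?X" if "y \<in> b" for y
        using that by (simp add: scaleC_scaleC scaleC_minus_one span_neg span_base)
      thus "(\<lambda>x. \<i> *\<^sub>C x) ` ?X \<subseteq> span ?X" by (auto intro: span_base)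
    qed simp
    finally show ?thesis .
  qed
  show "?L \<subseteq> span ?X"
  proof (rule complex_vector.span_minimal)
    show "complex_vector.subspace (span ?X)"
      unfolding complex_vector.subspace_def
    proof (intro conjI ballI allI)
      fix c x assume "x \<in> span ?X"
      thus "c *\<^sub>C x \<in> span ?X"
        unfolding scaleC_Re_Im[of c] by (intro span_add span_scale ii)
    qed (auto intro: span_add span_zero)
  qed (auto intro: span_base)
  show "span ?X \<subseteq> ?L"
  proof (rule span_minimal)
    show "subspace ?L" by (rule complex_subspace_imp_subspace) simp
  qed (auto intro: complex_vector.span_base complex_vector.span_scale)
qed

lemma fin_dim_iff_complex_span:
  "fin_dim (V :: 'a :: complex_vector set) \<longleftrightarrow> (\<exists>b. finite b \<and> V \<subseteq> complex_vector.span b)"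
proof
  assume "fin_dim V"
  then obtain b where "finite b" "V \<subseteq> span b" by (auto simp: fin_dim_def)
  moreover have "span b \<subseteq> complex_vector.span b"
    unfolding complex_span_eq_span by (intro span_mono) auto
  ultimately show "\<exists>b. finite b \<and> V \<subseteq> complex_vector.span b" by blast
next
  assume "\<exists>b. finite b \<and> V \<subseteq> complex_vector.span b"
  thus "fin_dim V" unfolding fin_dim_def complex_span_eq_span by (metis finite_Un finite_imageI)
qed

lemma fredholm_UNIV_iff:
  assumes W: "W \<in> bounded_ops"
  shows "fredholm UNIV (blinfun_apply W) \<longleftrightarrow> fredholm_map W"
proof -
  have "(\<exists>b. finite b \<and> complex_vector.span (range W \<union> b) = UNIV) \<longleftrightarrow>
      (\<exists>b. finite b \<and> span (range W \<union> b) = UNIV)"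
  proof
    assume "\<exists>b. finite b \<and> complex_vector.span (range W \<union> b) = UNIV"
    then obtain b where b: "finite b" "complex_vector.span (range W \<union> b) = UNIV" by blast
    \<comment> \<open>The range of the complex-linear \<open>W\<close> is already stable under \<i>,
      so only the finite set \<open>b\<close> has to be enlarged.\<close>
    have "(\<lambda>x. \<i> *\<^sub>C x) ` range W \<subseteq> range W"
      using W by (auto simp: bounded_ops_def) (metis rangeI)
    hence "complex_vector.span (range W \<union> b) \<subseteq> span (range W \<union> (b \<union> (\<lambda>x. \<i> *\<^sub>C x) ` b))"
      unfolding complex_span_eq_span by (intro span_mono) auto
    with b show "\<exists>b. finite b \<and> span (range W \<union> b) = UNIV"
      by (intro exI[of _ "b \<union> (\<lambda>x. \<i> *\<^sub>C x) ` b"]) auto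
  next
    assume "\<exists>b. finite b \<and> span (range W \<union> b) = UNIV"
    then obtain b where b: "finite b" "span (range W \<union> b) = UNIV" by blast
    have "span (range W \<union> b) \<subseteq> complex_vector.span (range W \<union> b)"
      unfolding complex_span_eq_span by (intro span_mono) auto
    with b show "\<exists>b. finite b \<and> complex_vector.span (range W \<union> b) = UNIV" by auto
  qed
  thus ?thesis by (simp add: fredholm_def fredholm_map_def fin_dim_iff_complex_span)
qed

section \<open>Complex-linear bounded operators, resolvents and the essential spectrum\<close>

lemma bounded_ops_scaleC: "T \<in> bounded_ops \<Longrightarrow> blinfun_apply T (c *\<^sub>C x) = c *\<^sub>C T x"
  by (simp add: bounded_ops_def)

lemma bounded_ops_diff: "S \<in> bounded_ops \<Longrightarrow> T \<in> bounded_ops \<Longrightarrow> S - T \<in> bounded_ops"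
  by (simp add: bounded_ops_def blinfun.diff_left scaleC_diff_right)

lemma bounded_ops_id: "id_blinfun \<in> bounded_ops"
  by (simp add: bounded_ops_def)

lemma bounded_ops_scaleC_op: "T \<in> bounded_ops \<Longrightarrow> c *\<^sub>C T \<in> bounded_ops"
  by (simp add: bounded_ops_def scaleC_blinfun.rep_eq scaleC_scaleC mult.commute)

lemma compact_ops_iff: "T \<in> compact_ops \<longleftrightarrow> T \<in> bounded_ops \<and> compact_map T"
  by (simp add: compact_ops_def compact_map_def)

lemma compact_map_scaleC:
  fixes T :: "'a :: complex_normed_vector \<Rightarrow>\<^sub>L 'b :: complex_normed_vector"
  assumes "compact_map T"
  shows "compact_map (c *\<^sub>C T)"
proof -
  have "c *\<^sub>C T = (c *\<^sub>C id_blinfun) o\<^sub>L T"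
    by (rule blinfun_eqI) (simp add: scaleC_blinfun.rep_eq)
  thus ?thesis using compact_map_compose_left[OF assms] by simp
qed

context
  fixes D :: "'h :: complex_normed_vector set" and A z
  assumes A: "closed_densely_defined D A" and z: "z \<in> resolvent_set D A"
begin

lemma resolvent_in: "resolvent D A z v \<in> D"
  and resolvent_right: "A (resolvent D A z v) - z *\<^sub>C resolvent D A z v = v"
  and resolvent_left: "x \<in> D \<Longrightarrow> resolvent D A z (A x - z *\<^sub>C x) = x"
proof -
  let ?f = "\<lambda>x. A x - z *\<^sub>C x"
  have bij: "bij_betw ?f D UNIV" and bl: "bounded_linear (inv_into D ?f)"
    using z by (auto simp: resolvent_set_def)
  have R: "resolvent D A z v = inv_into D ?f v" for v
    by (simp add: resolvent_def bounded_linear_Blinfun_apply bl)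
  have im: "?f ` D = UNIV" "inj_on ?f D" using bij by (auto simp: bij_betw_def)
  show "resolvent D A z v \<in> D" unfolding R by (rule inv_into_into) (simp add: im)
  show "A (resolvent D A z v) - z *\<^sub>C resolvent D A z v = v"
    unfolding R using f_inv_into_f[of v ?f D] im by simp
  show "x \<in> D \<Longrightarrow> resolvent D A z (A x - z *\<^sub>C x) = x"
    unfolding R by (rule inv_into_f_f[OF im(2)])
qed

lemma domain_scaleC: "x \<in> D \<Longrightarrow> c *\<^sub>C x \<in> D"
  and operator_scaleC: "x \<in> D \<Longrightarrow> A (c *\<^sub>C x) = c *\<^sub>C A x"
  using A by (auto simp: closed_densely_defined_def complex_vector.subspace_def)

lemma resolvent_bounded_ops: "resolvent D A z \<in> bounded_ops"
  unfolding bounded_ops_def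
proof (intro CollectI allI)
  fix c v
  let ?R = "blinfun_apply (resolvent D A z)"
  have "A (c *\<^sub>C ?R v) - z *\<^sub>C c *\<^sub>C ?R v = c *\<^sub>C (A (?R v) - z *\<^sub>C ?R v)"
    by (simp add: operator_scaleC resolvent_in scaleC_diff_right scaleC_scaleC mult.commute)
  also have "\<dots> = c *\<^sub>C v" by (simp add: resolvent_right)
  finally show "?R (c *\<^sub>C v) = c *\<^sub>C ?R v"
    using resolvent_left[OF domain_scaleC[OF resolvent_in], of c v] by simp
qed

text \<open>The resolvent \<open>R\<close> maps the space bijectively onto \<open>D\<close>, and
  \<open>(A - l) R = 1 - (l - z) R\<close>, so the ranges agree. A kernel vector \<open>v\<close> on
  the right satisfies \<open>v = (l - z) R v\<close>; hence the two kernels coincide if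
  \<open>l\<close> differs from \<open>z\<close> and both vanish if \<open>l = z\<close>.\<close>

lemma fredholm_iff_fredholm_map:
  "fredholm D (\<lambda>x. A x - l *\<^sub>C x) \<longleftrightarrow> fredholm_map (id_blinfun - (l - z) *\<^sub>C resolvent D A z)"
    (is "_ \<longleftrightarrow> fredholm_map ?W")
proof -
  let ?R = "blinfun_apply (resolvent D A z)"
  have W: "?W v = v - (l - z) *\<^sub>C ?R v" for v
    by (simp add: blinfun.diff_left scaleC_blinfun.rep_eq)
  have WR: "A (?R v) - l *\<^sub>C ?R v = ?W v" for v
    unfolding W using resolvent_right[of v]
    by (simp add: complex_vector.scale_left_diff_distrib algebra_simps)
  have DR: "D = range ?R"
  proof
    show "D \<subseteq> range ?R" using resolvent_left by (metis rangeI subsetI)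
  qed (use resolvent_in in auto)
  have "(\<lambda>x. A x - l *\<^sub>C x) ` D = (\<lambda>x. A x - l *\<^sub>C x) ` range ?R"
    using DR by (rule arg_cong)
  hence "(\<lambda>x. A x - l *\<^sub>C x) ` D = range ?W"
    by (simp only: image_image WR)
  moreover have "(\<exists>b. finite b \<and> {x \<in> D. A x - l *\<^sub>C x = 0} \<subseteq> complex_vector.span b) \<longleftrightarrow>
      (\<exists>b. finite b \<and> {v. ?W v = 0} \<subseteq> complex_vector.span b)"
  proof -
    have "v \<in> complex_vector.span b"
      if b: "{x \<in> D. A x - l *\<^sub>C x = 0} \<subseteq> complex_vector.span b" and v: "?W v = 0" for v b
    proof -
      have "?R v \<in> complex_vector.span b" using b v WR[of v] resolvent_in[of v] by auto
      hence "(l - z) *\<^sub>C ?R v \<in> complex_vector.span b" by (rule complex_vector.span_scale)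
      thus ?thesis using v by (simp add: W)
    qed
    moreover have "x \<in> complex_vector.span b"
      if b: "{v. ?W v = 0} \<subseteq> complex_vector.span b" and x: "x \<in> D" "A x - l *\<^sub>C x = 0" for x b
    proof -
      obtain v where v: "x = ?R v" using x(1) DR by blast
      have Wv: "?W v = 0" using x(2) WR v by simp
      have vx: "v = (l - z) *\<^sub>C x" using Wv by (simp add: W v)
      show ?thesis
      proof (cases "l = z")
        case True
        hence "v = 0" using vx by simp
        thus ?thesis using v by (simp add: blinfun.zero_right complex_vector.span_zero)
      next
        case False
        have "v \<in> complex_vector.span b" using b Wv by auto
        hence "inverse (l - z) *\<^sub>C v \<in> complex_vector.span b" by (rule complex_vector.span_scale)
        thus ?thesis using False by (simp add: vx scaleC_scaleC scaleC_one)
      qed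
    qed
    ultimately show ?thesis by blast
  qed
  ultimately have "fredholm D (\<lambda>x. A x - l *\<^sub>C x) \<longleftrightarrow> fredholm UNIV (blinfun_apply ?W)"
    by (simp add: fredholm_def)
  also have "\<dots> \<longleftrightarrow> fredholm_map ?W"
    by (intro fredholm_UNIV_iff bounded_ops_diff bounded_ops_id bounded_ops_scaleC_op
        resolvent_bounded_ops)
  finally show ?thesis .
qed

end

text \<open>The bounded operators standing for \<open>A - l\<close> and \<open>B - l\<close> differ
  by \<open>l - z\<close> times the compact resolvent difference; adding it or its negative gives
  the two directions.\<close>

theorem essential_spectrum_compact_perturbation:
  fixes A B :: "'h :: chilbert_space \<Rightarrow> 'h"
  assumes A: "closed_densely_defined DA A" and B: "closed_densely_defined DB B"
    and "compact_perturbation DB B DA A"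
  shows "essential_spectrum DB B = essential_spectrum DA A"
proof -
  obtain z where z: "z \<in> resolvent_set DA A" "z \<in> resolvent_set DB B"
    and K: "compact_map (resolvent DA A z - resolvent DB B z)"
    using assms(3) by (auto simp: compact_perturbation_def compact_ops_iff)
  let ?WA = "\<lambda>l. id_blinfun - (l - z) *\<^sub>C resolvent DA A z"
  let ?WB = "\<lambda>l. id_blinfun - (l - z) *\<^sub>C resolvent DB B z"
  let ?C = "\<lambda>l. (l - z) *\<^sub>C (resolvent DA A z - resolvent DB B z)"
  have C: "compact_map (?C l)" for l by (rule compact_map_scaleC[OF K])
  have "?WB l = ?WA l + ?C l" "?WA l = ?WB l + - ?C l" for l
    by (simp_all add: scaleC_diff_right)
  hence "fredholm_map (?WB l) \<longleftrightarrow> fredholm_map (?WA l)" for l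
    using fredholm_map_add_compact[OF _ C] fredholm_map_add_compact[OF _ compact_map_minus[OF C]]
    by metis
  thus ?thesis
    by (simp add: essential_spectrum_def fredholm_iff_fredholm_map[OF A z(1)]
        fredholm_iff_fredholm_map[OF B z(2)])
qed

text \<open>The pointwise lift has a closed graph because \<iota> is continuous and injective. This
  turns an inclusion of ranges, such as that of a resolvent in \<G>, into boundedness for the
  stronger norm.\<close>

lemma bounded_lift_through_injection:
  fixes \<iota> :: "'g :: banach \<Rightarrow>\<^sub>L 'h :: real_normed_vector" and R :: "'a :: banach \<Rightarrow>\<^sub>L 'h"
  assumes inj: "inj (blinfun_apply \<iota>)" and R: "range (blinfun_apply R) \<subseteq> range (blinfun_apply \<iota>)"
  obtains Q :: "'a \<Rightarrow>\<^sub>L 'g" where "\<iota> o\<^sub>L Q = R"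
proof -
  obtain q where q: "\<And>x. \<iota> (q x) = R x" 
  proof -
    have "\<exists>y. \<iota> y = R x" for x
    proof -
      have "R x \<in> range \<iota>" using R by blast
      thus ?thesis by (auto simp: image_iff eq_commute)
    qed
    thus ?thesis using that by (metis (mono_tags))
  qed
  have eq: "q x = y" if "\<iota> y = R x" for x y using inj that q by (metis injD)
  have "bounded_linear q"
  proof (rule closed_graph_bounded_linear)
    show "linear q"
      by (rule linearI; rule eq;
          simp add: q blinfun.add_right blinfun.scaleR_right)
  next
    fix X x y assume X: "X \<longlonglongrightarrow> x" "(\<lambda>n. q (X n)) \<longlonglongrightarrow> y"
    have "(\<lambda>n. \<iota> (q (X n))) \<longlonglongrightarrow> \<iota> y" by (intro tendsto_intros X)
    moreover have "(\<lambda>n. \<iota> (q (X n))) \<longlonglongrightarrow> R x" unfolding q by (intro tendsto_intros X)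
    ultimately show "y = q x" using eq LIMSEQ_unique by metis
  qed
  hence "\<iota> o\<^sub>L Blinfun q = R"
    by (intro blinfun_eqI) (simp add: bounded_linear_Blinfun_apply q)
  thus ?thesis by (rule that)
qed

section \<open>Adjoints, the adjoint space and the extended resolvent\<close>

lemma cinner_eqI:
  assumes "\<And>c. inner (c *\<^sub>C x) y = inner (c *\<^sub>C x') y'"
  shows "cinner x y = cinner x' y'"
  using assms[of 1] assms[of \<i>]
  by (simp add: inner_eq_Re_cinner cinner_scaleC_left complex_eq_iff)

lemma inner_scaleC_left: "inner (c *\<^sub>C x) y = inner x (cnj c *\<^sub>C (y :: 'a :: complex_inner))"
  by (simp add: inner_eq_Re_cinner cinner_scaleC_left cinner_scaleC_right)

text \<open>The real adjoint already serves: by complex linearity of \<open>T\<close>, the identity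
  of real parts at all multiples of \<open>x\<close> gives the full complex identity.\<close>

lemma adjoint_exists:
  fixes T :: "'a :: chilbert_space \<Rightarrow>\<^sub>L 'b :: complex_inner"
  assumes T: "T \<in> bounded_ops"
  shows "\<exists>T' :: 'b \<Rightarrow>\<^sub>L 'a. T' \<in> bounded_ops \<and> (\<forall>x y. cinner (T x) y = cinner x (T' y))"
proof -
  obtain T' :: "'b \<Rightarrow>\<^sub>L 'a" where T': "\<And>x y. inner (T x) y = inner x (T' y)"
    using real_adjoint_exists[of T] by blast
  have "cinner (T x) y = cinner x (T' y)" for x y
    by (rule cinner_eqI) (simp add: T' flip: bounded_ops_scaleC[OF T])
  moreover have "T' (c *\<^sub>C y) = c *\<^sub>C T' y" for c y
  proof (rule vector_eq_ldot[THEN iffD1], rule allI)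
    fix x
    have "inner x (T' (c *\<^sub>C y)) = inner (T (cnj c *\<^sub>C x)) y"
      by (simp add: inner_scaleC_left bounded_ops_scaleC[OF T] flip: T')
    thus "inner x (T' (c *\<^sub>C y)) = inner x (c *\<^sub>C T' y)"
      by (simp add: T' inner_scaleC_left)
  qed
  hence "T' \<in> bounded_ops" by (simp add: bounded_ops_def)
  ultimately show ?thesis by blast
qed

lemma antidual_eqI:
  "(\<And>g. blinfun_of_antidual \<phi> g = blinfun_of_antidual \<psi> g) \<Longrightarrow> \<phi> = \<psi>"
  by (metis blinfun_eqI blinfun_of_antidual_inject)

lemma antidual_scaleC:
  "blinfun_of_antidual \<phi> (c *\<^sub>C g) = cnj c * blinfun_of_antidual \<phi> g"
  by transfer simp

lemma bounded_linear_gelfand_embedding: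
  fixes \<iota> :: "'g :: chilbert_space \<Rightarrow>\<^sub>L 'h :: chilbert_space"
  assumes "\<iota> \<in> bounded_ops"
  shows "bounded_linear (gelfand_embedding \<iota>)"
proof (rule bounded_linear_intro[where K = "norm \<iota>"])
  note [simp] = blinfun_of_gelfand_embedding[OF assms]
  fix v w r
  show "gelfand_embedding \<iota> (v + w) = gelfand_embedding \<iota> v + gelfand_embedding \<iota> w"
    by (rule antidual_eqI) (simp add: plus_antidual.rep_eq blinfun.add_left cinner_add_right)
  show "gelfand_embedding \<iota> (r *\<^sub>R v) = r *\<^sub>R gelfand_embedding \<iota> v"
  proof (rule antidual_eqI)
    fix g
    have "r *\<^sub>R v = complex_of_real r *\<^sub>C v" by (simp add: scaleR_scaleC)
    thus "blinfun_of_antidual (gelfand_embedding \<iota> (r *\<^sub>R v)) g =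
        blinfun_of_antidual (r *\<^sub>R gelfand_embedding \<iota> v) g"
      by (simp add: scaleR_antidual.rep_eq blinfun.scaleR_left cinner_scaleC_right scaleR_conv_of_real)
  qed
  show "norm (gelfand_embedding \<iota> v) \<le> norm v * norm \<iota>"
    unfolding norm_antidual.rep_eq
  proof (rule norm_blinfun_bound)
    fix g
    have "cmod (cinner (\<iota> g) v) \<le> norm (\<iota> g) * norm v" by (rule cmod_cinner_le)
    also have "\<dots> \<le> (norm \<iota> * norm g) * norm v"
      by (intro mult_right_mono norm_blinfun norm_ge_zero)
    finally show "norm (blinfun_of_antidual (gelfand_embedding \<iota> v) g) \<le> norm v * norm \<iota> * norm g"
      by (simp add: mult_ac)
  qed simp
qed

text \<open>\<open>gelfand_embedding id_blinfun\<close> is the Riesz map onto the adjoint space. The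
  real part of \<phi> determines \<open>u\<close>, and evaluation at \<open>\<i> *\<^sub>C g\<close>
  recovers the imaginary part.\<close>

lemma antidual_riesz:
  fixes \<phi> :: "'g :: chilbert_space antidual"
  shows "\<exists>u. \<phi> = gelfand_embedding id_blinfun u"
proof -
  have "bounded_linear (\<lambda>g. Re (blinfun_of_antidual \<phi> g))"
    by (rule bounded_linear_compose[OF bounded_linear_Re blinfun.bounded_linear_right])
  then obtain u where u: "\<And>g. Re (blinfun_of_antidual \<phi> g) = inner g u"
    using riesz_representation by blast
  have "Im (blinfun_of_antidual \<phi> g) = Im (cinner g u)" for g
    using u[of "\<i> *\<^sub>C g"] by (simp add: antidual_scaleC inner_eq_Re_cinner cinner_scaleC_left)
  hence "blinfun_of_antidual \<phi> g = cinner g u" for g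
    using u[of g] by (simp add: complex_eq_iff inner_eq_Re_cinner)
  hence "\<phi> = gelfand_embedding id_blinfun u"
    by (intro antidual_eqI) (simp add: blinfun_of_gelfand_embedding[OF bounded_ops_id])
  thus ?thesis by blast
qed

text \<open>Density of \<H> in the adjoint space, in the form that makes the extended resolvent
  unique. Through the Riesz map \<open>E\<close> the embedding becomes the adjoint
  \<open>\<iota>'\<close>, whose range is dense because \<iota> is injective.\<close>

lemma eq_zero_of_vanishes_on_gelfand_embedding:
  fixes \<iota> :: "'g :: chilbert_space \<Rightarrow>\<^sub>L 'h :: chilbert_space"
    and X :: "'g antidual \<Rightarrow>\<^sub>L 'k :: {real_inner}"
  assumes \<iota>: "\<iota> \<in> bounded_ops" "inj (blinfun_apply \<iota>)"
    and X: "\<And>v. X (gelfand_embedding \<iota> v) = 0"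
  shows "X = 0"
proof -
  define E where "E = Blinfun (gelfand_embedding (id_blinfun :: 'g \<Rightarrow>\<^sub>L 'g))"
  have E: "E u = gelfand_embedding id_blinfun u" for u
    by (simp add: E_def bounded_linear_Blinfun_apply bounded_linear_gelfand_embedding bounded_ops_id)
  obtain \<iota>' :: "'h \<Rightarrow>\<^sub>L 'g" where "\<iota>' \<in> bounded_ops"
    and \<iota>': "\<And>x y. cinner (\<iota> x) y = cinner x (\<iota>' y)"
    using adjoint_exists[OF \<iota>(1)] by blast
  have emb: "gelfand_embedding \<iota> v = E (\<iota>' v)" for v
    by (rule antidual_eqI)
      (simp add: E blinfun_of_gelfand_embedding[OF bounded_ops_id] blinfun_of_gelfand_embedding[OF \<iota>(1)] \<iota>')
  obtain X' where X': "\<And>g w. inner ((X o\<^sub>L E) g) w = inner g (blinfun_apply X' w)"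
    using real_adjoint_exists[of "X o\<^sub>L E"] by blast
  have "X' w = 0" for w
  proof -
    have "inner (\<iota>' v) (X' w) = 0" for v using X[of v] by (simp add: emb flip: X')
    hence "inner v (\<iota> (X' w)) = 0" for v
      by (metis \<iota>' cinner_commute complex_cnj inner_eq_Re_cinner inner_commute)
    from this[of "\<iota> (X' w)"] have "\<iota> (X' w) = \<iota> 0" by (simp add: blinfun.zero_right)
    thus ?thesis using \<iota>(2) by (meson injD)
  qed
  hence "inner ((X o\<^sub>L E) g) ((X o\<^sub>L E) g) = 0" for g by (simp only: X' inner_zero_right)
  hence XE: "X (E g) = 0" for g by simp
  show "X = 0"
  proof (rule blinfun_eqI)
    fix \<phi>
    obtain u where "\<phi> = E u" using antidual_riesz[of \<phi>] E by auto
    thus "X \<phi> = blinfun_apply 0 \<phi>" by (simp add: XE)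
  qed
qed

text \<open>The adjoint \<open>R'\<close> of the resolvent takes values in the adjoint domain, so it
  lifts to a bounded \<open>Q\<close> into \<G>. The extension \<open>e\<close> is the transpose of
  \<open>Q\<close> on the adjoint space, followed by the Riesz identification of \<H>; density makes
  it the only one.\<close>

lemma extended_resolvent:
  fixes \<iota> :: "'g :: chilbert_space \<Rightarrow>\<^sub>L 'h :: chilbert_space"
  assumes \<iota>: "\<iota> \<in> bounded_ops" "inj (blinfun_apply \<iota>)"
    and A: "closed_densely_defined D A" and z: "z \<in> resolvent_set D A"
    and adj: "adjoint_domain D A \<subseteq> range (blinfun_apply \<iota>)"
  shows "extended_resolvent \<iota> D A z \<in> bounded_ops"
    and "extended_resolvent \<iota> D A z (gelfand_embedding \<iota> v) = resolvent D A z v"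
proof -
  let ?R = "resolvent D A z"
  have Rb: "?R \<in> bounded_ops" by (rule resolvent_bounded_ops[OF A z])
  obtain R' :: "'h \<Rightarrow>\<^sub>L 'h" where R': "R' \<in> bounded_ops" "\<And>x y. cinner (?R x) y = cinner x (R' y)"
    using adjoint_exists[OF Rb] by blast
  have "R' u \<in> adjoint_domain D A" for u
  proof -
    \<comment> \<open>The witness is the value of the adjoint of \<open>A\<close> at
      \<open>R' u\<close>, since \<open>R'\<close> inverts that adjoint minus
      \<open>cnj z\<close>.\<close>
    have "cinner (R' u) (A x) = cinner (u + cnj z *\<^sub>C R' u) x" if x: "x \<in> D" for x
    proof -
      have "cinner (R' u) (A x - z *\<^sub>C x) = cinner u x"
        using R'(2)[of "A x - z *\<^sub>C x" u] resolvent_left[OF A z x] by (metis cinner_commute)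
      moreover have "cinner (R' u) (A x) = cinner (R' u) (A x - z *\<^sub>C x) + z * cinner (R' u) x"
        by (simp flip: cinner_scaleC_right cinner_add_right)
      ultimately show ?thesis by (simp add: cinner_add_left cinner_scaleC_left)
    qed
    thus ?thesis by (auto simp: adjoint_domain_def)
  qed
  hence "range R' \<subseteq> range \<iota>" using adj by blast
  then obtain Q :: "'h \<Rightarrow>\<^sub>L 'g" where "\<iota> o\<^sub>L Q = R'"
    using bounded_lift_through_injection[OF \<iota>(2)] by blast
  hence Q: "\<iota> (Q u) = R' u" for u by (metis blinfun_apply_blinfun_compose)
  have Qc: "Q (c *\<^sub>C u) = c *\<^sub>C Q u" for c u
    by (rule injD[OF \<iota>(2)]) (simp add: Q bounded_ops_scaleC R' \<iota>)
  have "\<exists>w. \<forall>u. Re (blinfun_of_antidual \<phi> (Q u)) = inner u w" for \<phi>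
    by (intro riesz_representation bounded_linear_compose[OF bounded_linear_Re]
        bounded_linear_compose[OF blinfun.bounded_linear_right] blinfun.bounded_linear_right)
  then obtain e where e: "\<And>\<phi> u. Re (blinfun_of_antidual \<phi> (Q u)) = inner u (e \<phi>)" by metis
  have "bounded_linear e"
  proof (rule bounded_linear_intro[where K = "norm Q"])
    fix \<phi> \<psi> r
    show "e (\<phi> + \<psi>) = e \<phi> + e \<psi>" "e (r *\<^sub>R \<phi>) = r *\<^sub>R e \<phi>"
      by (rule vector_eq_ldot[THEN iffD1];
          simp add: inner_simps plus_antidual.rep_eq scaleR_antidual.rep_eq blinfun.add_left
            blinfun.scaleR_left flip: e)+
    have "norm (e \<phi>) * norm (e \<phi>) = Re (blinfun_of_antidual \<phi> (Q (e \<phi>)))"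
      by (simp add: e power2_norm_eq_inner flip: power2_eq_square)
    also have "\<dots> \<le> norm (blinfun_of_antidual \<phi> (Q (e \<phi>)))" by (rule complex_Re_le_cmod)
    also have "\<dots> \<le> norm \<phi> * norm (Q (e \<phi>))"
      unfolding norm_antidual.rep_eq by (rule norm_blinfun)
    also have "\<dots> \<le> norm \<phi> * (norm Q * norm (e \<phi>))"
      by (intro mult_left_mono norm_blinfun norm_ge_zero)
    finally show "norm (e \<phi>) \<le> norm \<phi> * norm Q"
      by (cases "norm (e \<phi>) = 0") (simp_all add: mult_le_cancel_right flip: mult.assoc)
  qed
  hence eB: "Blinfun e \<phi> = e \<phi>" for \<phi> by (simp add: bounded_linear_Blinfun_apply)
  have "e (c *\<^sub>C \<phi>) = c *\<^sub>C e \<phi>" for c \<phi>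
  proof (rule vector_eq_ldot[THEN iffD1], rule allI)
    fix u
    have "inner u (c *\<^sub>C e \<phi>) = inner (cnj c *\<^sub>C u) (e \<phi>)" by (simp add: inner_scaleC_left)
    also have "\<dots> = inner u (e (c *\<^sub>C \<phi>))"
      by (simp add: Qc antidual_scaleC scaleC_antidual.rep_eq scaleC_blinfun.rep_eq
          scaleC_complex_def flip: e)
    finally show "inner u (e (c *\<^sub>C \<phi>)) = inner u (c *\<^sub>C e \<phi>)" ..
  qed
  hence 1: "Blinfun e \<in> bounded_ops" by (simp add: bounded_ops_def eB)
  have 2: "Blinfun e (gelfand_embedding \<iota> v) = ?R v" for v
  proof (rule vector_eq_ldot[THEN iffD1], rule allI)
    fix u
    have "inner u (e (gelfand_embedding \<iota> v)) = Re (cinner (R' u) v)"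
      by (simp add: blinfun_of_gelfand_embedding[OF \<iota>(1)] Q flip: e)
    also have "\<dots> = inner (?R v) u"
      by (metis R'(2) inner_eq_Re_cinner inner_commute)
    finally show "inner u (Blinfun e (gelfand_embedding \<iota> v)) = inner u (?R v)"
      by (simp add: eB inner_commute)
  qed
  have "extended_resolvent \<iota> D A z = Blinfun e"
    unfolding extended_resolvent_def
  proof (rule the_equality)
    show "Blinfun e \<in> bounded_ops \<and> (\<forall>v. Blinfun e (gelfand_embedding \<iota> v) = ?R v)"
      using 1 2 by blast
  next
    fix X assume "X \<in> bounded_ops \<and> (\<forall>v. blinfun_apply X (gelfand_embedding \<iota> v) = ?R v)"
    hence "X - Blinfun e = 0"
      by (intro eq_zero_of_vanishes_on_gelfand_embedding[OF \<iota>]) (simp add: blinfun.diff_left 2)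
    thus "X = Blinfun e" by simp
  qed
  with 1 2 show "extended_resolvent \<iota> D A z \<in> bounded_ops"
    "extended_resolvent \<iota> D A z (gelfand_embedding \<iota> v) = ?R v" by simp_all
qed

section \<open>Left decay\<close>

text \<open>
  For a net \<open>F\<close> that is an approximate unit, these are the \<open>W\<close> with
  \<open>J W \<rightarrow> W\<close> in norm; the property passes to closed spans, unlike an explicit factorization.
\<close>

definition left_absorbed ::
    "('h :: complex_normed_vector \<Rightarrow>\<^sub>L 'h) filter \<Rightarrow> ('f :: complex_normed_vector \<Rightarrow>\<^sub>L 'h) set"
  where "left_absorbed F = {W. ((\<lambda>J. norm ((J o\<^sub>L W) - W)) \<longlongrightarrow> 0) F}"

lemma blinfun_compose_diff_left: "(S - S') o\<^sub>L T = (S o\<^sub>L T) - (S' o\<^sub>L T)"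
  by (rule blinfun_eqI) (simp add: blinfun.diff_left)

lemma blinfun_compose_add_right: "S o\<^sub>L (T + T') = (S o\<^sub>L T) + (S o\<^sub>L T')"
  by (rule blinfun_eqI) (simp add: blinfun.add_left blinfun.add_right)

lemma blinfun_compose_diff_right: "S o\<^sub>L (T - T') = (S o\<^sub>L T) - (S o\<^sub>L T')"
  by (rule blinfun_eqI) (simp add: blinfun.diff_left blinfun.diff_right)

lemma blinfun_compose_scaleC_right:
  "S \<in> bounded_ops \<Longrightarrow> S o\<^sub>L (c *\<^sub>C T) = c *\<^sub>C (S o\<^sub>L T)"
  by (rule blinfun_eqI) (simp add: scaleC_blinfun.rep_eq bounded_ops_scaleC)

lemma blinfun_compose_assoc: "(R o\<^sub>L S) o\<^sub>L T = R o\<^sub>L (S o\<^sub>L T)"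
  by (rule blinfun_eqI) simp

lemma left_absorbed_compose:
  fixes T :: "'e :: complex_normed_vector \<Rightarrow>\<^sub>L 'f :: complex_normed_vector"
    and W :: "'f \<Rightarrow>\<^sub>L 'h :: complex_normed_vector"
  assumes "W \<in> left_absorbed F"
  shows "W o\<^sub>L T \<in> left_absorbed F"
proof -
  have "((\<lambda>J. norm ((J o\<^sub>L W) - W) * norm T) \<longlongrightarrow> 0) F"
    using assms by (intro tendsto_mult_left_zero) (simp add: left_absorbed_def)
  hence "((\<lambda>J. norm ((J o\<^sub>L (W o\<^sub>L T)) - (W o\<^sub>L T))) \<longlongrightarrow> 0) F"
  proof (rule Lim_null_comparison[rotated], intro always_eventually allI)
    fix J
    have "(J o\<^sub>L (W o\<^sub>L T)) - (W o\<^sub>L T) = ((J o\<^sub>L W) - W) o\<^sub>L T"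
      by (simp add: blinfun_compose_diff_left blinfun_compose_assoc)
    thus "norm (norm ((J o\<^sub>L (W o\<^sub>L T)) - (W o\<^sub>L T))) \<le> norm ((J o\<^sub>L W) - W) * norm T"
      using norm_blinfun_compose[of "(J o\<^sub>L W) - W" T] by simp
  qed
  thus ?thesis by (simp add: left_absorbed_def)
qed

context
  fixes F :: "('h :: complex_normed_vector \<Rightarrow>\<^sub>L 'h) filter" and C :: real
  assumes F: "\<forall>\<^sub>F J in F. J \<in> bounded_ops \<and> norm J \<le> C"
begin

lemma complex_subspace_left_absorbed:
  "complex_vector.subspace (left_absorbed F :: ('f :: complex_normed_vector \<Rightarrow>\<^sub>L 'h) set)"
  unfolding complex_vector.subspace_def
proof (intro conjI ballI allI)
  show "(0 :: 'f \<Rightarrow>\<^sub>L 'h) \<in> left_absorbed F" by (simp add: left_absorbed_def)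
next
  fix V W :: "'f \<Rightarrow>\<^sub>L 'h" assume VW: "V \<in> left_absorbed F" "W \<in> left_absorbed F"
  have "((\<lambda>J. norm ((J o\<^sub>L V) - V) + norm ((J o\<^sub>L W) - W)) \<longlongrightarrow> 0) F"
    using VW by (intro tendsto_add_zero) (simp_all add: left_absorbed_def)
  hence "((\<lambda>J. norm ((J o\<^sub>L (V + W)) - (V + W))) \<longlongrightarrow> 0) F"
  proof (rule Lim_null_comparison[rotated], intro always_eventually allI)
    fix J
    show "norm (norm ((J o\<^sub>L (V + W)) - (V + W))) \<le> norm ((J o\<^sub>L V) - V) + norm ((J o\<^sub>L W) - W)"
      using norm_diff_triangle_ineq[of "J o\<^sub>L V" "J o\<^sub>L W" V W]
      by (simp add: blinfun_compose_add_right)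
  qed
  thus "V + W \<in> left_absorbed F" by (simp add: left_absorbed_def)
next
  fix c and W :: "'f \<Rightarrow>\<^sub>L 'h" assume W: "W \<in> left_absorbed F"
  have "((\<lambda>J. cmod c * norm ((J o\<^sub>L W) - W)) \<longlongrightarrow> 0) F"
    using W by (intro tendsto_mult_right_zero) (simp add: left_absorbed_def)
  \<comment> \<open>Pulling \<open>c\<close> through \<open>J\<close> requires \<open>J\<close> to
    be complex-linear, which is known only eventually along \<open>F\<close>.\<close>
  moreover have "\<forall>\<^sub>F J in F. cmod c * norm ((J o\<^sub>L W) - W) = norm ((J o\<^sub>L c *\<^sub>C W) - c *\<^sub>C W)"
    using F by eventually_elim
      (simp add: blinfun_compose_scaleC_right norm_scaleC flip: scaleC_diff_right)
  ultimately show "c *\<^sub>C W \<in> left_absorbed F"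
    unfolding left_absorbed_def mem_Collect_eq by (rule Lim_transform_eventually)
qed

text \<open>The norm bound on \<open>J\<close> is uniform along \<open>F\<close>, so replacing
  \<open>W\<close> by a nearby \<open>V n\<close> changes \<open>J W - W\<close> by at most a fixed
  multiple of \<open>norm (V n - W)\<close>.\<close>

lemma closed_left_absorbed: "closed (left_absorbed F :: ('f :: complex_normed_vector \<Rightarrow>\<^sub>L 'h) set)"
  unfolding closed_sequential_limits
proof (intro allI impI, elim conjE)
  fix V :: "nat \<Rightarrow> 'f \<Rightarrow>\<^sub>L 'h" and W
  assume V: "\<forall>n. V n \<in> left_absorbed F" "V \<longlonglongrightarrow> W"
  have "\<forall>\<^sub>F J in F. norm ((J o\<^sub>L W) - W) < e" if e: "e > 0" for e
  proof -
    define K where "K = \<bar>C\<bar> + 1"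
    have K: "K > 0" by (simp add: K_def)
    obtain n where n: "norm (V n - W) < e / (2 * K)"
      using V(2) e K unfolding LIMSEQ_iff by (metis divide_pos_pos mult_pos_pos order_refl zero_less_numeral)
    have "\<forall>\<^sub>F J in F. norm ((J o\<^sub>L V n) - V n) < e / 2"
      using V(1) e order_tendstoD(2)[of _ 0 F "e / 2"] by (auto simp: left_absorbed_def)
    with F show ?thesis
    proof eventually_elim
      case (elim J)
      have "(J o\<^sub>L W) - W = ((J o\<^sub>L V n) - V n) - ((J o\<^sub>L (V n - W)) - (V n - W))"
        by (simp add: blinfun_compose_diff_right)
      hence "norm ((J o\<^sub>L W) - W) \<le>
          norm ((J o\<^sub>L V n) - V n) + norm ((J o\<^sub>L (V n - W)) - (V n - W))"
        by (metis norm_triangle_ineq4)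
      also have "norm ((J o\<^sub>L (V n - W)) - (V n - W)) \<le> norm (J o\<^sub>L (V n - W)) + norm (V n - W)"
        by (rule norm_triangle_ineq4)
      also have "norm (J o\<^sub>L (V n - W)) \<le> norm J * norm (V n - W)" by (rule norm_blinfun_compose)
      also have "norm J * norm (V n - W) \<le> \<bar>C\<bar> * norm (V n - W)"
        using elim by (intro mult_right_mono) auto
      finally have "norm ((J o\<^sub>L W) - W) \<le> norm ((J o\<^sub>L V n) - V n) + K * norm (V n - W)"
        by (simp add: K_def algebra_simps)
      also have "K * norm (V n - W) < e / 2" using n K by (simp add: field_simps)
      finally show ?case using elim by simp
    qed
  qed
  hence "((\<lambda>J. norm ((J o\<^sub>L W) - W)) \<longlongrightarrow> 0) F"
    by (auto simp: tendsto_iff)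
  thus "W \<in> left_absorbed F" by (simp add: left_absorbed_def)
qed

end

context
  fixes MH :: "('h :: cbanach \<Rightarrow>\<^sub>L 'h) set" and F :: "('h \<Rightarrow>\<^sub>L 'h) filter" and C :: real
  assumes MH: "MH \<subseteq> bounded_ops"
    and F: "\<forall>\<^sub>F J in F. J \<in> MH \<and> norm J \<le> C"
    and unit: "\<And>M. M \<in> MH \<Longrightarrow> ((\<lambda>J. norm ((J o\<^sub>L M) - M)) \<longlongrightarrow> 0) F"
begin

lemma bounded_filter: "\<forall>\<^sub>F J in F. J \<in> bounded_ops \<and> norm J \<le> C"
  using F by eventually_elim (use MH in auto)

lemma B0l_subset_left_absorbed: "B0l MH \<subseteq> left_absorbed F"
  unfolding B0l_def
proof (intro closure_minimal complex_vector.span_minimal closed_left_absorbed[OF bounded_filter]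
    complex_subspace_left_absorbed[OF bounded_filter])
  have "M \<in> left_absorbed F" if "M \<in> MH" for M
    using unit[OF that] by (simp add: left_absorbed_def)
  thus "{S o\<^sub>L T |S T. S \<in> MH \<and> T \<in> bounded_ops} \<subseteq> left_absorbed F"
    using left_absorbed_compose by blast
qed

text \<open>On a generator \<open>S o\<^sub>L T'\<close> the factor \<open>X o\<^sub>L S\<close>
  belongs to \<open>B0l MH\<close> by left decay preservation and is therefore absorbed. The general
  case follows because composition with \<open>X\<close> pulls the closed subspace of absorbed
  operators back to a closed subspace.\<close>

lemma Bql_compose_B0l_left_absorbed:
  fixes X :: "'k :: cbanach \<Rightarrow>\<^sub>L 'h" and T :: "'f :: complex_normed_vector \<Rightarrow>\<^sub>L 'k"
  assumes X: "X \<in> Bql MK MH" and T: "T \<in> B0l MK"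
  shows "X o\<^sub>L T \<in> left_absorbed F"
proof -
  have Xb: "X \<in> bounded_ops" using X by (simp add: Bql_def)
  let ?G = "(\<lambda>T :: 'f \<Rightarrow>\<^sub>L 'k. X o\<^sub>L T) -` left_absorbed F"
  have "B0l MK \<subseteq> ?G"
    unfolding B0l_def
  proof (intro closure_minimal complex_vector.span_minimal)
    have "S o\<^sub>L T' \<in> ?G" if S: "S \<in> MK" for S and T' :: "'f \<Rightarrow>\<^sub>L 'k"
    proof -
      have "X o\<^sub>L S \<in> left_absorbed F"
        using X S B0l_subset_left_absorbed by (auto simp: Bql_def)
      hence "(X o\<^sub>L S) o\<^sub>L T' \<in> left_absorbed F" by (rule left_absorbed_compose)
      thus ?thesis by (simp add: blinfun_compose_assoc)
    qed
    thus "{S o\<^sub>L T |S T. S \<in> MK \<and> T \<in> bounded_ops} \<subseteq> ?G" by auto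
    show "complex_vector.subspace ?G"
    proof (intro complex_vector.subspaceI)
      note sub = complex_subspace_left_absorbed[OF bounded_filter]
      show "0 \<in> ?G" using complex_vector.subspace_0[OF sub] by simp
      show "V + W \<in> ?G" if "V \<in> ?G" "W \<in> ?G" for V W
        using that by (simp add: blinfun_compose_add_right complex_vector.subspace_add[OF sub])
      show "c *\<^sub>C W \<in> ?G" if "W \<in> ?G" for c W
        using that by (simp add: blinfun_compose_scaleC_right[OF Xb] complex_vector.subspace_scale[OF sub])
    qed
    show "closed ?G"
      by (intro closed_vimage closed_left_absorbed[OF bounded_filter] continuous_intros)
  qed
  thus ?thesis using T by blast
qed

end

text \<open>The second resolvent identity, carried out in the adjoint space. At
  \<open>g = Q v\<close> the form \<open>(Bt - z) g\<close> is the embedded \<open>v\<close>;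
  subtracting \<open>(At - z) g\<close> and applying the extended resolvent leaves the difference of
  the resolvents at \<open>v\<close>.\<close>

lemma resolvent_difference:
  fixes \<iota> :: "'g :: chilbert_space \<Rightarrow>\<^sub>L 'h :: chilbert_space"
  assumes \<iota>: "\<iota> \<in> bounded_ops" "inj (blinfun_apply \<iota>)"
    and A: "closed_densely_defined DA A" and B: "closed_densely_defined DB B"
    and zA: "z \<in> resolvent_set DA A" and zB: "z \<in> resolvent_set DB B"
    and core: "closure (blinfun_apply \<iota> -` DA) = UNIV"
    and adj: "adjoint_domain DA A \<subseteq> range (blinfun_apply \<iota>)"
    and At: "extends_to \<iota> DA A At" and Bt: "extends_to \<iota> DB B Bt"
    and Q: "\<iota> o\<^sub>L Q = resolvent DB B z"
  shows "resolvent DA A z - resolvent DB B z = extended_resolvent \<iota> DA A z o\<^sub>L ((Bt - At) o\<^sub>L Q)"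
proof (rule blinfun_eqI)
  fix v
  let ?X = "extended_resolvent \<iota> DA A z"
  note emb = bounded_linear_gelfand_embedding[OF \<iota>(1)]
  interpret emb: bounded_linear "gelfand_embedding \<iota>" by (rule emb)
  note ext = extended_resolvent(2)[OF \<iota> A zA adj]
  \<comment> \<open>On vectors mapped into \<open>DA\<close> this is the resolvent equation. Both
    sides are continuous in \<open>g\<close> for the norm of \<G>, in which these vectors are
    dense.\<close>
  have left_inverse: "?X (At g - gelfand_embedding \<iota> (z *\<^sub>C \<iota> g)) = \<iota> g" for g
  proof -
    have "UNIV \<subseteq> {g. ?X (At g - gelfand_embedding \<iota> (z *\<^sub>C \<iota> g)) = \<iota> g}"
      unfolding core[symmetric]
    proof (rule closure_minimal)
      have "continuous_on UNIV (\<lambda>g. gelfand_embedding \<iota> (z *\<^sub>C \<iota> g))"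
        by (intro linear_continuous_on bounded_linear_compose[OF emb] bounded_linear_scaleC_comp
            blinfun.bounded_linear_right)
      thus "closed {g. ?X (At g - gelfand_embedding \<iota> (z *\<^sub>C \<iota> g)) = \<iota> g}"
        by (intro closed_Collect_eq continuous_intros)
      show "\<iota> -` DA \<subseteq> {g. ?X (At g - gelfand_embedding \<iota> (z *\<^sub>C \<iota> g)) = \<iota> g}"
      proof clarsimp
        fix g assume g: "\<iota> g \<in> DA"
        have "At g = gelfand_embedding \<iota> (A (\<iota> g))" using At g by (simp add: extends_to_def)
        hence "At g - gelfand_embedding \<iota> (z *\<^sub>C \<iota> g) = gelfand_embedding \<iota> (A (\<iota> g) - z *\<^sub>C \<iota> g)"
          by (simp add: emb.diff)
        thus "?X (At g - gelfand_embedding \<iota> (z *\<^sub>C \<iota> g)) = \<iota> g"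
          by (simp only: ext resolvent_left[OF A zA g])
      qed
    qed
    thus ?thesis by blast
  qed
  have Qv: "\<iota> (Q v) = resolvent DB B z v" using Q by (metis blinfun_apply_blinfun_compose)
  have "Bt (Q v) = gelfand_embedding \<iota> (B (\<iota> (Q v)))"
    using Bt resolvent_in[OF B zB, of v] by (simp add: extends_to_def Qv)
  hence "Bt (Q v) - gelfand_embedding \<iota> (z *\<^sub>C \<iota> (Q v)) = gelfand_embedding \<iota> v"
    using resolvent_right[OF B zB, of v] by (simp add: Qv flip: emb.diff)
  hence "(Bt - At) (Q v) = gelfand_embedding \<iota> v - (At (Q v) - gelfand_embedding \<iota> (z *\<^sub>C \<iota> (Q v)))"
    by (simp add: blinfun.diff_left algebra_simps)
  hence "?X ((Bt - At) (Q v)) = resolvent DA A z v - resolvent DB B z v"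
    by (simp only: blinfun.diff_right[of _ "gelfand_embedding \<iota> v"] ext left_inverse) (simp add: Qv)
  thus "(resolvent DA A z - resolvent DB B z) v = (?X o\<^sub>L ((Bt - At) o\<^sub>L Q)) v"
    by (simp add: blinfun.diff_left)
qed

section \<open>Compactness of the resolvent difference\<close>

theorem theorem3p2:
  fixes \<iota> :: "'g :: chilbert_space \<Rightarrow>\<^sub>L 'h :: chilbert_space"
    and MH :: "('h \<Rightarrow>\<^sub>L 'h) set"
    and MK :: "('k :: cbanach \<Rightarrow>\<^sub>L 'k) set"
    and DA DB :: "'h set"
    and A B :: "'h \<Rightarrow> 'h"
    and At Bt :: "'g \<Rightarrow>\<^sub>L 'g antidual"
    and S :: "'k \<Rightarrow>\<^sub>L 'g antidual"
    and T :: "'g \<Rightarrow>\<^sub>L 'k"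
  assumes "compact_friedrichs_module \<iota> MH"
    and "closed_densely_defined DA A"
    and "closed_densely_defined DB B"
    and "resolvent_set DA A \<inter> resolvent_set DB B \<noteq> {}"
    and "DA \<subseteq> range (blinfun_apply \<iota>)"
    and "closure (blinfun_apply \<iota> -` DA) = UNIV"
    and "adjoint_domain DA A \<subseteq> range (blinfun_apply \<iota>)"
    and "DB \<subseteq> range (blinfun_apply \<iota>)"
    and "extends_to \<iota> DA A At"
    and "extends_to \<iota> DB B Bt"
    and "banach_module MK"
    and "S \<in> bounded_ops"
    and "T \<in> B0l MK"
    and "Bt - At = S o\<^sub>L T"
    and "\<exists>z \<in> resolvent_set DA A \<inter> resolvent_set DB B.
           extended_resolvent \<iota> DA A z o\<^sub>L S \<in> Bql MK MH"
  shows "compact_perturbation DB B DA A \<and>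
    essential_spectrum DB B = essential_spectrum DA A"
proof -
  note A = assms(2) and B = assms(3)
  have \<iota>: "\<iota> \<in> bounded_ops" "inj (blinfun_apply \<iota>)"
    and MH: "banach_module MH" "MH \<subseteq> bounded_ops"
    and cpt: "\<And>M. M \<in> MH \<Longrightarrow> compact_map (M o\<^sub>L \<iota>)"
    using assms(1)
    by (auto simp: compact_friedrichs_module_def friedrichs_module_def hilbert_module_def
        banach_module_def compact_ops_iff)
  obtain F C where F: "F \<noteq> bot" "\<forall>\<^sub>F J in F. J \<in> MH \<and> norm J \<le> C"
    "\<And>M. M \<in> MH \<Longrightarrow> ((\<lambda>J. norm ((J o\<^sub>L M) - M)) \<longlongrightarrow> 0) F"
    using MH(1) unfolding banach_module_def has_approximate_unit_def by blast
  obtain z where zA: "z \<in> resolvent_set DA A" and zB: "z \<in> resolvent_set DB B"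
    and X: "extended_resolvent \<iota> DA A z o\<^sub>L S \<in> Bql MK MH"
    using assms(15) by blast
  let ?K = "resolvent DA A z - resolvent DB B z"
  have "range (resolvent DA A z) \<subseteq> range \<iota>" "range (resolvent DB B z) \<subseteq> range \<iota>"
    using resolvent_in[OF A zA] resolvent_in[OF B zB] assms(5,8) by blast+
  then obtain QA QB :: "'h \<Rightarrow>\<^sub>L 'g" where
    Q: "\<iota> o\<^sub>L QA = resolvent DA A z" "\<iota> o\<^sub>L QB = resolvent DB B z"
    using bounded_lift_through_injection[OF \<iota>(2)] by metis
  have "?K = ((extended_resolvent \<iota> DA A z o\<^sub>L S) o\<^sub>L T) o\<^sub>L QB"
    unfolding resolvent_difference[OF \<iota> A B zA zB assms(6,7,9,10) Q(2)] assms(14)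
    by (simp add: blinfun_compose_assoc)
  hence "?K \<in> left_absorbed F"
    using left_absorbed_compose[OF Bql_compose_B0l_left_absorbed[OF MH(2) F(2,3) X assms(13)]]
    by simp
  hence lim: "((\<lambda>J. norm ((J o\<^sub>L ?K) - ?K)) \<longlongrightarrow> 0) F" by (simp add: left_absorbed_def)
  have "compact_map ?K"
  proof (rule compact_map_approx)
    fix e :: real assume "e > 0"
    hence "\<forall>\<^sub>F J in F. norm ((J o\<^sub>L ?K) - ?K) < e" using lim by (auto dest: order_tendstoD)
    with F(2) have "\<forall>\<^sub>F J in F. J \<in> MH \<and> norm ((J o\<^sub>L ?K) - ?K) < e" by eventually_elim auto
    \<comment> \<open>Properness of \<open>F\<close> turns an eventual property into an actual
      multiplier \<open>J\<close>.\<close>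
    then obtain J where J: "J \<in> MH" "norm ((J o\<^sub>L ?K) - ?K) < e"
      using F(1) eventually_happens by blast
    \<comment> \<open>Both resolvents lift to \<G>, so the multiplier acts right after \<iota>,
      where compactness of the Friedrichs module applies.\<close>
    have "J o\<^sub>L ?K = (J o\<^sub>L \<iota>) o\<^sub>L (QA - QB)"
      unfolding Q[symmetric] by (simp add: blinfun_compose_diff_right blinfun_compose_assoc)
    hence "compact_map (J o\<^sub>L ?K)" using compact_map_compose_right[OF cpt[OF J(1)]] by simp
    thus "\<exists>S. compact_map S \<and> norm (S - ?K) < e" using J(2) by blast
  qed
  hence "?K \<in> compact_ops"
    by (simp add: compact_ops_iff bounded_ops_diff resolvent_bounded_ops[OF A zA]
        resolvent_bounded_ops[OF B zB])
  hence "compact_perturbation DB B DA A"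
    using zA zB by (auto simp: compact_perturbation_def)
  with essential_spectrum_compact_perturbation[OF A B] show ?thesis by blast
qed

end
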